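(* Let $t\ge 2$, $q\ge 0$ and $s_1,\dots,s_t\ge 3$ be integers, and let $G=K_1\vee (C_{s_1}\cup C_{s_2}\cup\cdots\cup C_{s_t}\cup qK_2)$. If $G$ has at least $52$ vertices, then $G$ is determined by its signless Laplacian spectrum: every simple graph whose signless Laplacian spectrum equals that of $G$ is isomorphic to $G$.
   Context: All graphs are finite, simple and undirected unless stated otherwise. $K_n$, $C_n$ denote the complete graph and the cycle on $n$ vertices; $G\cup H$ is the disjoint union; $qG$ is the disjoint union of $q$ copies of $G$ ($0K_2$ is the empty graph); $G\vee H$ is the join, obtained from $G\cup H$ by adding all edges between $V(G)$ and $V(H)$. The signless Laplacian of $G$ is $Q(G)=A(G)+D(G)$, where $A(G)$ is the adjacency matrix and $D(G)$ the diagonal matrix of vertex degrees; its eigenvalues (with multiplicities) form the signless Laplacian spectrum ($Q$-spectrum). *)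

theory Defs
  imports "Jordan_Normal_Form.Char_Poly"
begin

text \<open>A finite simple graph is represented by its number of vertices n (vertex set
  {0..<n}) and a symmetric irreflexive adjacency relation supported on {0..<n}.\<close>

type_synonym graph = "nat \<times> (nat \<Rightarrow> nat \<Rightarrow> bool)"

definition simple_graph :: "graph \<Rightarrow> bool" where
  "simple_graph G \<longleftrightarrow>
     (\<forall>i j. snd G i j \<longrightarrow> i < fst G \<and> j < fst G \<and> i \<noteq> j) \<and>
     (\<forall>i j. snd G i j \<longrightarrow> snd G j i)"

definition graph_iso :: "graph \<Rightarrow> graph \<Rightarrow> bool" where
  "graph_iso G H \<longleftrightarrow> (\<exists>f. bij_betw f {..<fst G} {..<fst H} \<and>
     (\<forall>i<fst G. \<forall>j<fst G. snd G i j \<longleftrightarrow> snd H (f i) (f j)))"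

definition empty_graph :: graph where
  "empty_graph = (0, \<lambda>_ _. False)"

definition K1 :: graph where
  "K1 = (1, \<lambda>_ _. False)"

definition K2 :: graph where
  "K2 = (2, \<lambda>i j. i < 2 \<and> j < 2 \<and> i \<noteq> j)"

definition cycle_graph :: "nat \<Rightarrow> graph" where
  "cycle_graph s = (s, \<lambda>i j. i < s \<and> j < s \<and> (j = Suc i mod s \<or> i = Suc j mod s))"

definition gunion :: "graph \<Rightarrow> graph \<Rightarrow> graph" where
  "gunion G H = (fst G + fst H, \<lambda>i j.
      (i < fst G \<and> j < fst G \<and> snd G i j) \<or>
      (fst G \<le> i \<and> fst G \<le> j \<and> i < fst G + fst H \<and> j < fst G + fst H \<and>
       snd H (i - fst G) (j - fst G)))"

definition gjoin :: "graph \<Rightarrow> graph \<Rightarrow> graph" where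
  "gjoin G H = (fst G + fst H, \<lambda>i j.
      snd (gunion G H) i j \<or>
      (i < fst G \<and> fst G \<le> j \<and> j < fst G + fst H) \<or>
      (j < fst G \<and> fst G \<le> i \<and> i < fst G + fst H))"

definition gunion_list :: "graph list \<Rightarrow> graph" where
  "gunion_list Gs = foldr gunion Gs empty_graph"

definition degree_of :: "graph \<Rightarrow> nat \<Rightarrow> nat" where
  "degree_of G i = card {k. k < fst G \<and> snd G i k}"

definition signless_laplacian :: "graph \<Rightarrow> real mat" where
  "signless_laplacian G = mat (fst G) (fst G) (\<lambda>(i, j).
      (if snd G i j then 1 else 0) + (if i = j then real (degree_of G i) else 0))"

definition Q_spectrum :: "graph \<Rightarrow> real \<Rightarrow> nat" where
  "Q_spectrum G = (\<lambda>x. order x (char_poly (signless_laplacian G)))"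

end

theory Submission
  imports Defs "Jordan_Normal_Form.Schur_Decomposition" "HOL-Library.Nat_Bijection"
begin

text \<open>
  Real symmetric matrices with the same characteristic polynomial are orthogonally similar, so every
  bound on the quadratic form of Q(G) carries over to a cospectral mate H. The form of G is at least
  the squared norm, which forces minimum degree 2 in H; it is at most 5 times the squared norm on a
  hyperplane, and G has an eigenvalue l > n. The latter gives H a vertex of degree at least 26, and
  then the hyperplane bound excludes degrees above 4 elsewhere. The traces of Q and its square
  now leave only the degree sequence of G, so that H is a cone over a graph with degrees 1 and 2.
  The eigenvector for l shows that no edge of the base joins vertices of different degrees.

  A Schur complement removes the apex: the bases have the same characteristic polynomial as well. On a
  disjoint union of cycles, oriented by a permutation s, the traces of Chebyshev polynomials count the
  fixed points of all powers of s, and these numbers determine s up to conjugation.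
\<close>

section \<open>Real symmetric matrices\<close>

text \<open>The hyperplane on which the form of H is at most 5 times the squared norm is unknown: it
  is the preimage of the hyperplane of vectors vanishing at the apex of G. So a degree in H is
  bounded by a whole plane of test vectors, which meets every hyperplane. The constants fit together
  as follows: l > 52 gives a degree of at least 26, and on the test plane the surplus 26 - 5 = 21
  must pay for a cross term that costs at most 8. The eigenvalue l is a root of x = n - 1 + (sum of
  1 / (x + 1 - 2 d) over the base degrees d). This equation sees only how many base vertices have
  each degree, so it is the same for a mate as soon as the degree sequences agree, even if the
  structure of the mate is still open. The difference of its two sides is also the Schur factor of
  the apex, which therefore cancels between G and H. Two-vertex components disturb the trace count:
  there B - 3 is the swap minus the identity and not s + s^-1. Their number is known by then, so
  their share of each trace can be subtracted.\<close>

lemma symmetric_real_char_poly_splits: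
  fixes A :: "real mat"
  assumes A: "A \<in> carrier_mat n n" and sym: "transpose_mat A = A"
  shows "\<exists>es. char_poly A = (\<Prod>e\<leftarrow>es. [:- e, 1:])"
proof -
  define C where "C = map_mat complex_of_real A"
  have C: "C \<in> carrier_mat n n" using A by (auto simp: C_def)
  have Asym: "A $$ (j, i) = A $$ (i, j)" if "i < n" "j < n" for i j
    using that A arg_cong[OF sym, of "\<lambda>M. M $$ (i, j)"] by auto
  obtain as where as: "char_poly C = (\<Prod>a\<leftarrow>as. [:- a, 1:])"
    using char_poly_factorized[OF C] by blast
  have real: "complex_of_real (Re a) = a" if "a \<in> set as" for a
  proof -
    have "poly (char_poly C) a = 0"
      using that unfolding as by (induction as) auto
    then obtain v where v: "v \<in> carrier_vec n" "v \<noteq> 0\<^sub>v n" "C *\<^sub>v v = a \<cdot>\<^sub>v v"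
      using eigenvalue_root_char_poly[OF C, of a] C by (auto simp: eigenvalue_def eigenvector_def)
    have row: "(\<Sum>j<n. of_real (A $$ (i, j)) * v $ j) = a * v $ i" if "i < n" for i
      using arg_cong[OF v(3), of "\<lambda>w. w $ i"] that v(1) A
      by (auto simp: C_def scalar_prod_def lessThan_atLeast0)
    \<comment> \<open>\<open>q\<close> is the Hermitian form of \<open>A\<close> at
      \<open>v\<close>. Symmetry makes it real, and it is \<open>a\<close> times the positive number
      \<open>r\<close>, so \<open>a\<close> is real.\<close>
    define q where "q = (\<Sum>i<n. \<Sum>j<n. of_real (A $$ (i, j)) * v $ j * cnj (v $ i))"
    have q: "q = a * (\<Sum>i<n. v $ i * cnj (v $ i))"
    proof -
      have "q = (\<Sum>i<n. (\<Sum>j<n. of_real (A $$ (i, j)) * v $ j) * cnj (v $ i))"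
        by (simp add: q_def sum_distrib_right)
      also have "\<dots> = (\<Sum>i<n. a * v $ i * cnj (v $ i))"
        by (rule sum.cong[OF refl]) (simp add: row)
      finally show ?thesis by (simp add: sum_distrib_left mult.assoc)
    qed
    have "cnj q = (\<Sum>i<n. \<Sum>j<n. of_real (A $$ (i, j)) * cnj (v $ j) * v $ i)"
      by (simp add: q_def)
    also have "\<dots> = (\<Sum>j<n. \<Sum>i<n. of_real (A $$ (i, j)) * cnj (v $ j) * v $ i)"
      by (rule sum.swap)
    also have "\<dots> = q"
      unfolding q_def by (intro sum.cong refl) (simp add: Asym)
    finally have "cnj q = q" .
    define r where "r = (\<Sum>i<n. (cmod (v $ i))\<^sup>2)"
    have r: "(\<Sum>i<n. v $ i * cnj (v $ i)) = of_real r"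
      by (simp add: r_def complex_norm_square[symmetric] del: of_real_power)
    obtain i where i: "i < n" "v $ i \<noteq> 0"
      using v(1,2) by (metis carrier_vecD dim_vec index_zero_vec(1) eq_vecI zero_carrier_vec)
    have "r > 0"
      unfolding r_def using i by (intro sum_pos2[of _ i]) auto
    have "cnj a * of_real r = a * of_real r"
      using \<open>cnj q = q\<close> unfolding q r by simp
    hence "cnj a = a" using \<open>r > 0\<close> by simp
    thus ?thesis by (simp add: complex_eq_iff)
  qed
  have "map_poly complex_of_real (char_poly A) = (\<Prod>a\<leftarrow>as. [:- a, 1:])"
    unfolding as[symmetric] C_def by (rule of_real_hom.char_poly_hom[OF A, symmetric])
  also have "\<dots> = map_poly complex_of_real (\<Prod>e\<leftarrow>map Re as. [:- e, 1:])"
    using real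
  proof (induction as)
    case (Cons a as)
    interpret h: map_poly_comm_ring_hom complex_of_real ..
    have a: "[:- a, 1:] = map_poly complex_of_real [:- Re a, 1:]"
      using Cons.prems[of a] by simp
    show ?case
      using Cons.IH Cons.prems by (simp only: list.map prod_list.Cons h.hom_mult a list.set_intros)
  qed simp
  finally have "char_poly A = (\<Prod>e\<leftarrow>map Re as. [:- e, 1:])"
    using of_real_hom.coeff_map_poly_hom by (metis of_real_eq_iff poly_eqI)
  thus ?thesis by blast
qed

text \<open>Root orders, which are all that \<open>Q_spectrum\<close> records, thus determine the
  multiset of factors of a polynomial that splits.\<close>

lemma order_prod_linear_factors:
  fixes es :: "'a :: idom list"
  shows "Polynomial.order x (\<Prod>e\<leftarrow>es. [:- e, 1:]) = count (mset es) x"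
proof (induction es)
  case (Cons e es)
  have nz: "(\<Prod>e\<leftarrow>es. [:- e, 1:]) \<noteq> 0"
    by (auto simp: prod_list_zero_iff)
  have lin: "Polynomial.order x [:- e, 1:] = (if x = e then 1 else 0)"
    using order_power_n_n[of e 1] by (auto intro: order_0I)
  have "Polynomial.order x ([:- e, 1:] * (\<Prod>e\<leftarrow>es. [:- e, 1:])) = Polynomial.order x [:- e, 1:] + Polynomial.order x (\<Prod>e\<leftarrow>es. [:- e, 1:])"
    using nz by (intro order_mult) (simp only: mult_eq_0_iff, simp)
  thus ?case using Cons lin by simp
qed simp

text \<open>Deflation, one listed eigenvalue at a time: an orthonormal basis that starts with an
  eigenvector clears the first column, and symmetry then clears the first row. The diagonal follows
  the given list, so that two matrices with the same characteristic polynomial get literally the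
  same diagonal matrix.\<close>

lemma symmetric_real_diagonalization:
  fixes A :: "real mat"
  assumes "A \<in> carrier_mat n n" "transpose_mat A = A" "char_poly A = (\<Prod>e\<leftarrow>es. [:- e, 1:])"
  shows "\<exists>U \<in> carrier_mat n n. transpose_mat U * U = 1\<^sub>m n \<and> U * transpose_mat U = 1\<^sub>m n \<and>
    A = U * mat_diag n (\<lambda>i. es ! i) * transpose_mat U"
  using assms
proof (induction es arbitrary: n A)
  case Nil
  with degree_monic_char_poly[of A n] have "n = 0" by auto
  thus ?case using Nil by (intro bexI[of _ "1\<^sub>m 0"]) auto
next
  case (Cons e es n A)
  note A = Cons.prems(1) and sym = Cons.prems(2)
  have cp: "char_poly A = [: -e, 1 :] * (\<Prod>e \<leftarrow> es. [:- e, 1:])" using Cons.prems by auto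
  have "eigenvalue A e"
    unfolding eigenvalue_root_char_poly[OF A] cp by simp
  then obtain v where v: "v \<in> carrier_vec n" "v \<noteq> 0\<^sub>v n" "A *\<^sub>v v = e \<cdot>\<^sub>v v"
    using A by (auto simp: eigenvalue_def eigenvector_def)
  hence n: "n \<noteq> 0" by auto
  interpret cof_vec_space n "TYPE(real)" .
  define b where "b = basis_completion v"
  define ws where "ws = gram_schmidt n b"
  note bc = basis_completion[OF v(1,2), folded b_def]
  from bc(6,7) n obtain vs where bv: "b = v # vs" by (cases b, auto)
  from gram_schmidt_result[OF bc(2) bc(4) bc(5) refl, folded ws_def]
  have ws: "set ws \<subseteq> carrier_vec n" "corthogonal ws" "length ws = n" 
    by (auto simp: bc(6))
  have hd: "ws ! 0 = v"
    using gram_schmidt_hd[OF v(1), of vs, folded bv] ws(3) n unfolding ws_def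
    by (metis hd_conv_nth list.size(3))
  have wsc: "ws ! i \<in> carrier_vec n" if "i < n" for i using ws that by auto
  have orth: "ws ! i \<bullet> ws ! j = 0 \<longleftrightarrow> i \<noteq> j" if "i < n" "j < n" for i j
    using corthogonalD[OF ws(2), of i j] that ws(3) wsc[of j]
    by (simp add: conjugate_vec_def)
  have nonneg: "ws ! i \<bullet> ws ! i \<ge> 0" for i
    by (auto simp: scalar_prod_def intro: sum_nonneg)
  \<comment> \<open>Gram-Schmidt gives orthogonal vectors only; \<open>c\<close> normalizes them, so
    that the transpose of \<open>U\<close> is its inverse.\<close>
  define c where "c i = 1 / sqrt (ws ! i \<bullet> ws ! i)" for i
  have c: "c i * c i * (ws ! i \<bullet> ws ! i) = 1" if "i < n" for i
    using orth[OF that that] nonneg[of i] by (simp add: c_def)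
  define U where "U = mat n n (\<lambda>(i, j). c j * ws ! j $ i)"
  have U: "U \<in> carrier_mat n n" by (auto simp: U_def)
  have colU: "col U j = c j \<cdot>\<^sub>v ws ! j" if "j < n" for j
    using that wsc[OF that] by (auto simp: U_def)
  have UtU: "transpose_mat U * U = 1\<^sub>m n"
  proof (rule eq_matI)
    fix i j assume "i < dim_row (1\<^sub>m n)" "j < dim_col (1\<^sub>m n)"
    hence ij: "i < n" "j < n" by auto
    have "(transpose_mat U * U) $$ (i, j) = col U i \<bullet> col U j"
      using U ij by auto
    also have "\<dots> = c i * c j * (ws ! i \<bullet> ws ! j)"
      using wsc[OF ij(1)] wsc[OF ij(2)] by (simp add: colU ij)
    also have "\<dots> = (if i = j then 1 else 0)"
      using orth[OF ij] c[OF ij(1)] by auto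
    finally show "(transpose_mat U * U) $$ (i, j) = 1\<^sub>m n $$ (i, j)" using ij by simp
  qed (use U in auto)
  have Ut: "transpose_mat U \<in> carrier_mat n n" using U by auto
  have UUt: "U * transpose_mat U = 1\<^sub>m n"
    using mat_mult_left_right_inverse[OF Ut U UtU] .
  define A' where "A' = transpose_mat U * A * U"
  have A': "A' \<in> carrier_mat n n" using U A by (auto simp: A'_def)
  have symA': "transpose_mat A' = A'"
    unfolding A'_def using U Ut A sym
    by (simp add: transpose_mult[of _ n n _ n] transpose_mult[OF Ut A]  assoc_mult_mat[of _ n n _ n _ n])
  have A'i0: "A' $$ (i, 0) = (if i = 0 then e else 0)" if i: "i < n" for i
  proof -
    have "A' = transpose_mat U * (A * U)" unfolding A'_def using U Ut A by simp
    moreover have "(transpose_mat U * (A * U)) $$ (i, 0) = row (transpose_mat U) i \<bullet> col (A * U) 0"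
      by (rule index_mult_mat(1)) (use U A i n in auto)
    moreover have "row (transpose_mat U) i = col U i" using U i by simp
    moreover have "col (A * U) 0 = A *\<^sub>v col U 0" using col_mult2[OF A U] n by simp
    ultimately have "A' $$ (i, 0) = col U i \<bullet> (A *\<^sub>v col U 0)" by simp
    also have "A *\<^sub>v col U 0 = e \<cdot>\<^sub>v col U 0"
      using A v n hd by (simp add: colU mult_mat_vec smult_smult_assoc mult.commute)
    also have "col U i \<bullet> (e \<cdot>\<^sub>v col U 0) = e * (transpose_mat U * U) $$ (i, 0)"
      using U i n by simp
    finally show ?thesis using i n unfolding UtU by simp
  qed
  obtain m where m: "n = Suc m" using n by (cases n) auto
  define A3 where "A3 = mat m m (\<lambda>(i, j). A' $$ (Suc i, Suc j))"
  have A3: "A3 \<in> carrier_mat m m" by (auto simp: A3_def)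
  have A'sym: "A' $$ (j, i) = A' $$ (i, j)" if "i < n" "j < n" for i j
    using that A' arg_cong[OF symA', of "\<lambda>M. M $$ (i, j)"] by auto
  have symA3: "transpose_mat A3 = A3"
    by (rule eq_matI) (auto simp: A3_def A'sym m)
  have block: "A' = four_block_mat (mat 1 1 (\<lambda>_. e)) (0\<^sub>m 1 m) (0\<^sub>m m 1) A3"
  proof (rule eq_matI)
    fix i j
    assume "i < dim_row (four_block_mat (mat 1 1 (\<lambda>_. e)) (0\<^sub>m 1 m) (0\<^sub>m m 1) A3)"
      "j < dim_col (four_block_mat (mat 1 1 (\<lambda>_. e)) (0\<^sub>m 1 m) (0\<^sub>m m 1) A3)"
    hence ij: "i < n" "j < n" using A3 m by auto
    show "A' $$ (i, j) = four_block_mat (mat 1 1 (\<lambda>_. e)) (0\<^sub>m 1 m) (0\<^sub>m m 1) A3 $$ (i, j)"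
      using ij A'i0[of i] A'i0[of j] A'sym[of 0 j] A3 m
      by (cases i; cases j) (auto simp: A3_def)
  qed (use A' A3 m in auto)
  have "similar_mat A' A"
    by (rule similar_matI[of _ _ "transpose_mat U" U n]) (use A A' U Ut UtU UUt in \<open>auto simp: A'_def\<close>)
  hence "char_poly A' = [: -e, 1 :] * (\<Prod>e \<leftarrow> es. [:- e, 1:])"
    using char_poly_similar cp by metis
  also have "char_poly A' = char_poly (mat 1 1 (\<lambda>_. e)) * char_poly A3" 
    unfolding block by (rule char_poly_four_block_zeros_col) (use A3 in auto)
  also have "char_poly (mat 1 1 (\<lambda>_. e)) = [: -e,1 :]"
    by (simp add: char_poly_defs det_def sign_def)
  finally have "char_poly A3 = (\<Prod> e \<leftarrow> es. [:- e, 1:])"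
    by (metis mult_cancel_left pCons_eq_0_iff zero_neq_one)
  from Cons.IH[OF A3 symA3 this] obtain V where V: "V \<in> carrier_mat m m"
    "transpose_mat V * V = 1\<^sub>m m" "V * transpose_mat V = 1\<^sub>m m"
    "A3 = V * mat_diag m (\<lambda>i. es ! i) * transpose_mat V" by blast
  define X where "X = four_block_mat (1\<^sub>m 1) (0\<^sub>m 1 m) (0\<^sub>m m 1) V"
  have X: "X \<in> carrier_mat n n" using V m by (auto simp: X_def)
  have Xt: "transpose_mat X = four_block_mat (1\<^sub>m 1) (0\<^sub>m 1 m) (0\<^sub>m m 1) (transpose_mat V)"
    unfolding X_def using V by (subst transpose_four_block_mat[of _ 1 1 _ m _ m]) auto
  have one: "1\<^sub>m n = four_block_mat (1\<^sub>m 1) (0\<^sub>m 1 m) (0\<^sub>m m 1) (1\<^sub>m m)"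
    using m by (intro eq_matI) auto
  have XtX: "transpose_mat X * X = 1\<^sub>m n"
    unfolding Xt unfolding X_def one using V
    by (subst mult_four_block_mat[of _ 1 1 _ m _ m _ _ 1 _ m]) auto
  have XXt: "X * transpose_mat X = 1\<^sub>m n"
    unfolding Xt unfolding X_def one using V
    by (subst mult_four_block_mat[of _ 1 1 _ m _ m _ _ 1 _ m]) auto
  have D: "mat_diag n (\<lambda>i. (e # es) ! i) = four_block_mat (mat 1 1 (\<lambda>_. e)) (0\<^sub>m 1 m) (0\<^sub>m m 1) (mat_diag m (\<lambda>i. es ! i))"
    unfolding m mat_diag_def by (rule eq_matI) (auto simp: nth_Cons split: nat.splits)
  have A'D: "A' = X * mat_diag n (\<lambda>i. (e # es) ! i) * transpose_mat X"
  proof -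
    have Vt: "transpose_mat V \<in> carrier_mat m m" using V(1) by auto
    note z = left_mult_zero_mat[OF mat_diag_dim] left_mult_zero_mat[OF Vt] right_mult_zero_mat[OF mult_carrier_mat[OF V(1) mat_diag_dim]]
    have XD: "X * mat_diag n (\<lambda>i. (e # es) ! i) =
      four_block_mat (mat 1 1 (\<lambda>_. e)) (0\<^sub>m 1 m) (0\<^sub>m m 1) (V * mat_diag m (\<lambda>i. es ! i))"
      unfolding D unfolding X_def using V(1)
      by (subst mult_four_block_mat[of _ 1 1 _ m _ m _ _ 1 _ m]) (auto simp: z right_mult_zero_mat[OF V(1)])
    show ?thesis
      unfolding XD Xt block V(4) using V(1)
      by (subst mult_four_block_mat[of _ 1 1 _ m _ m _ _ 1 _ m]) (auto simp: z mult_carrier_mat[OF V(1) mat_diag_dim])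
  qed
  define D where "D = mat_diag n (\<lambda>i. (e # es) ! i)"
  have D: "D \<in> carrier_mat n n" by (simp add: D_def)
  have Xtc: "transpose_mat X \<in> carrier_mat n n" using X by auto
  define Y where "Y = U * X"
  have Y: "Y \<in> carrier_mat n n" using U X by (auto simp: Y_def)
  have Yt: "transpose_mat Y = transpose_mat X * transpose_mat U"
    unfolding Y_def by (rule transpose_mult[OF U X])
  have YtY: "transpose_mat Y * Y = 1\<^sub>m n"
  proof -
    have "transpose_mat Y * Y = transpose_mat X * ((transpose_mat U * U) * X)"
      unfolding Yt unfolding Y_def using U X Ut Xtc by (simp add: assoc_mult_mat[of _ n n _ n _ n])
    thus ?thesis unfolding UtU using X XtX by simp
  qed
  have YYt: "Y * transpose_mat Y = 1\<^sub>m n"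
    using mat_mult_left_right_inverse[OF _ Y YtY] Y by auto
  have "A = (U * transpose_mat U) * A * (U * transpose_mat U)"
    unfolding UUt using A by simp
  also have "\<dots> = U * A' * transpose_mat U"
    unfolding A'_def using U Ut A by (simp add: assoc_mult_mat[of _ n n _ n _ n])
  also have "\<dots> = Y * D * transpose_mat Y"
    unfolding A'D D_def[symmetric] Yt unfolding Y_def using U Ut X Xtc D
    by (simp add: assoc_mult_mat[of _ n n _ n _ n])
  finally show ?case using Y YtY YYt unfolding D_def by blast
qed

text \<open>Diagonalizing along the same list of roots, A = U D U^T and B = V D V^T, makes W = U V^T
  work.\<close>

lemma cospectral_symmetric_orthogonally_similar:
  fixes A B :: "real mat"
  assumes A: "A \<in> carrier_mat n n" "transpose_mat A = A"
    and B: "B \<in> carrier_mat n n" "transpose_mat B = B"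
    and eq: "char_poly A = char_poly B"
  obtains W where "W \<in> carrier_mat n n" "transpose_mat W * W = 1\<^sub>m n" "W * transpose_mat W = 1\<^sub>m n"
    "A = W * B * transpose_mat W"
proof -
  obtain es where es: "char_poly A = (\<Prod>e\<leftarrow>es. [:- e, 1:])"
    using symmetric_real_char_poly_splits[OF A] by blast
  define D where "D = mat_diag n (\<lambda>i. es ! i)"
  have D: "D \<in> carrier_mat n n" by (simp add: D_def)
  obtain U where U: "U \<in> carrier_mat n n" "transpose_mat U * U = 1\<^sub>m n" "U * transpose_mat U = 1\<^sub>m n"
    "A = U * D * transpose_mat U"
    using symmetric_real_diagonalization[OF A es] unfolding D_def by blast
  obtain V where V: "V \<in> carrier_mat n n" "transpose_mat V * V = 1\<^sub>m n" "V * transpose_mat V = 1\<^sub>m n"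
    "B = V * D * transpose_mat V"
    using symmetric_real_diagonalization[OF B es[unfolded eq]] unfolding D_def by blast
  have Ut: "transpose_mat U \<in> carrier_mat n n" and Vt: "transpose_mat V \<in> carrier_mat n n"
    using U V by auto
  define W where "W = U * transpose_mat V"
  have W: "W \<in> carrier_mat n n" using U V by (auto simp: W_def)
  have Wt: "transpose_mat W = V * transpose_mat U"
    unfolding W_def using transpose_mult[OF U(1) Vt] by simp
  note assoc = assoc_mult_mat[of _ n n _ n _ n]
  have "W * transpose_mat W = U * ((transpose_mat V * V) * transpose_mat U)"
    unfolding Wt unfolding W_def using U(1) V(1) Ut Vt by (simp add: assoc)
  hence WWt: "W * transpose_mat W = 1\<^sub>m n" unfolding V(2) using U Ut by simp
  hence WtW: "transpose_mat W * W = 1\<^sub>m n"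
    using mat_mult_left_right_inverse[OF W _ WWt] W by auto
  have "W * B * transpose_mat W = U * (transpose_mat V * V) * D * (transpose_mat V * V) * transpose_mat U"
    unfolding Wt V(4) unfolding W_def using U(1) V(1) Ut Vt D by (simp add: assoc)
  also have "\<dots> = A" unfolding V(2) U(4) using U(1) D by simp
  finally show ?thesis using that W WWt WtW by metis
qed

text \<open>Orders at real points suffice because both polynomials split over the reals; the common
  degree then gives the equal dimensions.\<close>

lemma symmetric_char_poly_eqI:
  fixes A B :: "real mat"
  assumes A: "A \<in> carrier_mat n n" "transpose_mat A = A"
    and B: "B \<in> carrier_mat m m" "transpose_mat B = B"
    and eq: "\<And>x. Polynomial.order x (char_poly A) = Polynomial.order x (char_poly B)"
  shows "char_poly A = char_poly B" and "n = m"
proof -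
  obtain as where as: "char_poly A = (\<Prod>e\<leftarrow>as. [:- e, 1:])"
    using symmetric_real_char_poly_splits[OF A] by blast
  obtain bs where bs: "char_poly B = (\<Prod>e\<leftarrow>bs. [:- e, 1:])"
    using symmetric_real_char_poly_splits[OF B] by blast
  have "mset as = mset bs"
    using eq unfolding as bs order_prod_linear_factors by (intro multiset_eqI) auto
  hence "mset (map (\<lambda>e. [:- e, 1:]) as) = mset (map (\<lambda>e. [:- e, 1:]) bs)" by simp
  thus "char_poly A = char_poly B"
    unfolding as bs by (metis prod_mset_prod_list)
  thus "n = m" using degree_monic_char_poly[OF A(1)] degree_monic_char_poly[OF B(1)] by simp
qed

section \<open>Permutations and orientations\<close>

lemma funpow_in: "f ` X \<subseteq> X \<Longrightarrow> x \<in> X \<Longrightarrow> (f ^^ i) x \<in> X"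
  by (induction i) auto

lemma funpow_periodic:
  assumes "finite X" "bij_betw f X X" "x \<in> X"
  obtains k where "k > 0" "(f ^^ k) x = x"
proof -
  have img: "f ` X \<subseteq> X" using assms(2) by (auto simp: bij_betw_def)
  have "\<not> inj (\<lambda>i. (f ^^ i) x)"
  proof
    assume "inj (\<lambda>i. (f ^^ i) x)"
    moreover have "range (\<lambda>i. (f ^^ i) x) \<subseteq> X" using funpow_in[OF img assms(3)] by auto
    ultimately show False using assms(1) by (meson finite_imageD finite_subset infinite_UNIV_nat)
  qed
  then obtain i j where ij: "i < j" "(f ^^ i) x = (f ^^ j) x"
    unfolding inj_def by (metis linorder_neqE_nat)
  have "bij_betw (f ^^ i) X X" using bij_betw_funpow[OF assms(2)] .
  moreover have "(f ^^ i) ((f ^^ (j - i)) x) = (f ^^ i) x"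
    using ij by (metis funpow_add comp_apply le_add_diff_inverse less_imp_le)
  ultimately have "(f ^^ (j - i)) x = x"
    using funpow_in[OF img assms(3)] assms(3) by (auto simp: bij_betw_def dest: inj_onD)
  thus ?thesis using that[of "j - i"] ij by simp
qed

definition cycle_of :: "('a \<Rightarrow> 'a) \<Rightarrow> nat \<Rightarrow> 'a \<Rightarrow> 'a set" where
  "cycle_of f k x = (\<lambda>i. (f ^^ i) x) ` {..<k}"

text \<open>No point of \<open>X\<close>, and not just \<open>x\<close>, has a period below
  \<open>k\<close>. Hence the orbit of \<open>x\<close> has exactly \<open>k\<close> points, and
  removing it lowers the number of fixed points of \<open>f ^^ m\<close> by an amount that depends
  on \<open>k\<close> and \<open>m\<close> only.\<close>

locale minimal_cycle =
  fixes f :: "'a \<Rightarrow> 'a" and X k x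
  assumes fin: "finite X" and bij: "bij_betw f X X" and x: "x \<in> X" and k: "k > 0"
    and per: "(f ^^ k) x = x"
    and least: "\<And>j y. 0 < j \<Longrightarrow> j < k \<Longrightarrow> y \<in> X \<Longrightarrow> (f ^^ j) y \<noteq> y"
begin

lemma img: "f ` X \<subseteq> X" using bij by (auto simp: bij_betw_def)

lemma pow_in: "(f ^^ i) x \<in> X" using funpow_in[OF img x] .

lemma pow_mod: "(f ^^ i) x = (f ^^ (i mod k)) x"
  using funpow_mod_eq[OF per] by metis

lemma cycle_of_eq: "cycle_of f k x = range (\<lambda>i. (f ^^ i) x)"
proof -
  have "(f ^^ i) x \<in> cycle_of f k x" for i
    unfolding cycle_of_def using pow_mod[of i] k by (auto intro!: image_eqI[of _ _ "i mod k"])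
  thus ?thesis unfolding cycle_of_def by auto
qed

lemma inj: "inj_on (\<lambda>i. (f ^^ i) x) {..<k}"
proof (rule linorder_inj_onI)
  fix i j assume ij: "i < j" "i \<in> {..<k}" "j \<in> {..<k}"
  have "(f ^^ (j - i)) ((f ^^ i) x) \<noteq> (f ^^ i) x"
    using least[of "j - i"] pow_in[of i] ij by auto
  moreover have "(f ^^ (j - i)) ((f ^^ i) x) = (f ^^ j) x"
    using ij by (metis funpow_add comp_apply le_add_diff_inverse2 less_imp_le)
  ultimately show "(f ^^ i) x \<noteq> (f ^^ j) x" by metis
qed auto

lemma card_cycle_of: "card (cycle_of f k x) = k"
  unfolding cycle_of_def using card_image[OF inj] by simp

lemma cycle_of_subset: "cycle_of f k x \<subseteq> X" unfolding cycle_of_eq using pow_in by auto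

lemma image_cycle_of: "f ` cycle_of f k x = cycle_of f k x"
proof (rule endo_inj_surj)
  show "finite (cycle_of f k x)" unfolding cycle_of_def by auto
  show "f ` cycle_of f k x \<subseteq> cycle_of f k x"
    unfolding cycle_of_eq by (auto intro: range_eqI[of _ _ "Suc _"])
  show "inj_on f (cycle_of f k x)" using bij cycle_of_subset by (meson bij_betw_def inj_on_subset)
qed

lemma bij_betw_diff_cycle_of: "bij_betw f (X - cycle_of f k x) (X - cycle_of f k x)"
proof -
  have "bij_betw f (cycle_of f k x) (cycle_of f k x)"
    using image_cycle_of bij cycle_of_subset by (auto simp: bij_betw_def intro: inj_on_subset)
  thus ?thesis using bij_betw_DiffI[OF bij _ cycle_of_subset cycle_of_subset] by blast
qed

lemma fixpoints_cycle_of: "{y \<in> cycle_of f k x. (f ^^ m) y = y} = (if k dvd m then cycle_of f k x else {})"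
proof -
  have "(f ^^ m) ((f ^^ i) x) = (f ^^ i) x \<longleftrightarrow> k dvd m" for i
  proof -
    have k0: "(f ^^ k) ((f ^^ i) x) = (f ^^ i) x"
      using per by (metis funpow_add comp_apply add.commute)
    have "(f ^^ m) ((f ^^ i) x) = (f ^^ (m mod k)) ((f ^^ i) x)"
      using funpow_mod_eq[OF k0] by metis
    thus ?thesis using least[of "m mod k", OF _ _ pow_in[of i]] k
      by (cases "m mod k = 0") (auto simp: dvd_eq_mod_eq_0)
  qed
  thus ?thesis unfolding cycle_of_eq by auto
qed

lemma card_fix_diff:
  "card {y \<in> X - cycle_of f k x. (f ^^ m) y = y} = card {y \<in> X. (f ^^ m) y = y} - (if k dvd m then k else 0)"
proof -
  have "{y \<in> X - cycle_of f k x. (f ^^ m) y = y} = {y \<in> X. (f ^^ m) y = y} - {y \<in> cycle_of f k x. (f ^^ m) y = y}"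
    by auto
  moreover have "card \<dots> = card {y \<in> X. (f ^^ m) y = y} - card {y \<in> cycle_of f k x. (f ^^ m) y = y}"
    using cycle_of_subset fin by (intro card_Diff_subset) (auto intro: finite_subset)
  ultimately show ?thesis using card_cycle_of unfolding fixpoints_cycle_of by auto
qed

end

text \<open>Induction that cuts off one shortest cycle. The least period can be read off the counts,
  so it is the same number \<open>k\<close> for both maps. Deleting a \<open>k\<close>-cycle on each
  side lowers the \<open>m\<close>-th count by \<open>k\<close> if \<open>k\<close> divides
  \<open>m\<close> and by 0 otherwise, so the counts stay equal.\<close>

theorem conjugate_if_card_fixpoints_eq:
  fixes f :: "'a \<Rightarrow> 'a" and g :: "'b \<Rightarrow> 'b"
  assumes "finite X" "finite Y" "bij_betw f X X" "bij_betw g Y Y"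
    and "\<And>k. card {x \<in> X. (f ^^ k) x = x} = card {y \<in> Y. (g ^^ k) y = y}"
  shows "\<exists>h. bij_betw h X Y \<and> (\<forall>x\<in>X. h (f x) = g (h x))"
  using assms
proof (induction "card X" arbitrary: X Y rule: less_induct)
  case less
  note fin = less.prems(1,2) and bij = less.prems(3,4) and eq = less.prems(5)
  have cXY: "card X = card Y" using eq[of 0] by simp
  show ?case
  proof (cases "X = {}")
    case True
    hence "Y = {}" using cXY fin by simp
    thus ?thesis using True by (auto simp: bij_betw_def)
  next
    case False
    then obtain a where "a \<in> X" by auto
    define P where "P k \<longleftrightarrow> k > 0 \<and> {x \<in> X. (f ^^ k) x = x} \<noteq> {}" for k
    have PY: "P k \<longleftrightarrow> k > 0 \<and> {y \<in> Y. (g ^^ k) y = y} \<noteq> {}" for k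
    proof -
      have f: "finite {x \<in> X. (f ^^ k) x = x}" "finite {y \<in> Y. (g ^^ k) y = y}" using fin by auto
      show ?thesis
        unfolding P_def card_0_eq[OF f(1), symmetric] card_0_eq[OF f(2), symmetric] eq ..
    qed
    have "\<exists>k. P k"
      using funpow_periodic[OF fin(1) bij(1) \<open>a \<in> X\<close>] \<open>a \<in> X\<close> unfolding P_def by blast
    define k where "k = (LEAST k. P k)"
    have Pk: "P k" unfolding k_def using \<open>\<exists>k. P k\<close> by (rule LeastI_ex)
    have min: "\<not> P j" if "j < k" for j using that unfolding k_def by (rule not_less_Least)
    obtain x where x: "x \<in> X" "(f ^^ k) x = x" using Pk unfolding P_def by auto
    obtain y where y: "y \<in> Y" "(g ^^ k) y = y" using Pk unfolding PY by auto
    interpret F: minimal_cycle f X k x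
      using fin bij x Pk min by unfold_locales (auto simp: P_def)
    interpret G: minimal_cycle g Y k y
      using fin bij y Pk min[unfolded PY] by unfold_locales (auto simp: PY)
    let ?C = "cycle_of f k x" and ?D = "cycle_of g k y"
    have "card (X - ?C) < card X"
      using F.cycle_of_subset F.card_cycle_of F.k fin(1)
      by (metis Diff_subset Diff_disjoint card.empty inf.absorb_iff2 inf_commute less_irrefl psubset_card_mono psubsetI)
    then obtain h where h: "bij_betw h (X - ?C) (Y - ?D)" "\<forall>x\<in>X - ?C. h (f x) = g (h x)"
      using less.hyps[of "X - ?C" "Y - ?D", OF _ _ _ F.bij_betw_diff_cycle_of G.bij_betw_diff_cycle_of] fin F.card_fix_diff G.card_fix_diff eq
      by auto
    \<comment> \<open>\<open>c\<close> carries the \<open>i\<close>-th point after \<open>x\<close>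
      to the \<open>i\<close>-th point after \<open>y\<close>; only \<open>i\<close> modulo
      \<open>k\<close> matters, as both cycles have length \<open>k\<close>.\<close>
    define c where "c z = (g ^^ (inv_into {..<k} (\<lambda>i. (f ^^ i) x) z)) y" for z
    have c: "c ((f ^^ i) x) = (g ^^ i) y" for i
    proof -
      have "inv_into {..<k} (\<lambda>i. (f ^^ i) x) ((f ^^ i) x) = i mod k"
        using inv_into_f_f[OF F.inj, of "i mod k"] F.k F.pow_mod[of i] by simp
      thus ?thesis using G.pow_mod[of i] by (simp add: c_def)
    qed
    have bc: "bij_betw c ?C ?D"
    proof (rule bij_betw_imageI)
      show img: "c ` ?C = ?D" unfolding F.cycle_of_eq G.cycle_of_eq using c by (auto simp: image_iff)
      show "inj_on c ?C"
        using img F.card_cycle_of G.card_cycle_of by (intro eq_card_imp_inj_on) (auto simp: cycle_of_def)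
    qed
    have cc: "c (f z) = g (c z)" if "z \<in> ?C" for z
    proof -
      obtain i where "z = (f ^^ i) x" using \<open>z \<in> ?C\<close> unfolding F.cycle_of_eq by auto
      thus ?thesis using c[of i] c[of "Suc i"] by simp
    qed
    let ?h = "\<lambda>z. if z \<in> ?C then c z else h z"
    have "bij_betw ?h (?C \<union> (X - ?C)) (?D \<union> (Y - ?D))"
    proof (rule bij_betw_combine)
      show "bij_betw ?h ?C ?D" using bc by (subst bij_betw_cong[of _ _ c]) auto
      show "bij_betw ?h (X - ?C) (Y - ?D)" using h(1) by (subst bij_betw_cong[of _ _ h]) auto
    qed auto
    moreover have "?C \<union> (X - ?C) = X" "?D \<union> (Y - ?D) = Y" using F.cycle_of_subset G.cycle_of_subset by auto
    moreover have "?h (f z) = g (?h z)" if "z \<in> X" for z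
    proof (cases "z \<in> ?C")
      case True
      hence "f z \<in> ?C" using F.image_cycle_of by blast
      thus ?thesis using True cc by simp
    next
      case False
      hence "f z \<in> X - ?C" using F.bij_betw_diff_cycle_of that by (auto simp: bij_betw_def)
      thus ?thesis using False h(2) that by simp
    qed
    ultimately show ?thesis by auto
  qed
qed

text \<open>Walking along the darts without turning back is a permutation of the darts that reversal
  conjugates to its inverse. No orbit contains a dart together with its reversal, so selecting one
  of the two orbits of each such pair orients every component as a directed cycle.\<close>

theorem orientation_exists:
  fixes R :: "nat \<Rightarrow> nat \<Rightarrow> bool"
  assumes fin: "finite X"
    and sym: "\<And>x y. R x y \<Longrightarrow> R y x" and irr: "\<And>x. \<not> R x x"
    and deg: "\<And>x. x \<in> X \<Longrightarrow> card {y \<in> X. R x y} = 1 \<or> card {y \<in> X. R x y} = 2"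
    and hom: "\<And>x y. x \<in> X \<Longrightarrow> y \<in> X \<Longrightarrow> R x y \<Longrightarrow> card {z \<in> X. R x z} = card {z \<in> X. R y z}"
  obtains s where "bij_betw s X X" "\<And>x y. x \<in> X \<Longrightarrow> y \<in> X \<Longrightarrow> R x y \<longleftrightarrow> y = s x \<or> x = s y"
proof -
  define N where "N x = {y \<in> X. R x y}" for x
  \<comment> \<open>Only darts at vertices of degree 2 are collected: at a vertex of degree 1 a walk
    cannot go on without turning back.\<close>
  define D where "D = {(x, y). x \<in> X \<and> y \<in> N x \<and> card (N x) = 2}"
  define oth where "oth y x = (THE z. z \<in> N y \<and> z \<noteq> x)" for x y
  define t where "t = (\<lambda>(x, y). (y, oth y x))"
  define r where "r = (\<lambda>(x::nat, y::nat). (y, x))"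
  have Nsym: "x \<in> N y" if "x \<in> X" "y \<in> N x" for x y using that sym by (auto simp: N_def)
  have Nhom: "card (N x) = card (N y)" if "x \<in> X" "y \<in> N x" for x y
    using hom[of x y] that by (auto simp: N_def)
  have NX: "y \<in> X" if "y \<in> N x" for x y using that by (auto simp: N_def)
  have xN: "x \<notin> N x" for x using irr by (auto simp: N_def)
  have oth: "oth y x \<in> N y" "oth y x \<noteq> x" "N y = {x, oth y x}" if "card (N y) = 2" "x \<in> N y" for x y
  proof -
    obtain z where z: "N y = {x, z}" "x \<noteq> z"
    proof -
      obtain a b where ab: "N y = {a, b}" "a \<noteq> b" using \<open>card (N y) = 2\<close> by (auto simp: card_2_iff)
      show ?thesis using ab \<open>x \<in> N y\<close> that[of a] that[of b] by (cases "x = a") (auto simp: insert_commute)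
    qed
    have "oth y x = z" unfolding oth_def using z by (intro the_equality) auto
    thus "oth y x \<in> N y" "oth y x \<noteq> x" "N y = {x, oth y x}" using z by auto
  qed
  have oth_eq: "oth y x = z" if "card (N y) = 2" "x \<in> N y" "z \<in> N y" "z \<noteq> x" for x y z
    using oth[OF that(1,2)] that by auto
  have rD: "r d \<in> D" if "d \<in> D" for d
  proof -
    obtain x y where d: "d = (x, y)" by force
    have "x \<in> X" "y \<in> N x" "card (N x) = 2" using that d by (auto simp: D_def)
    thus ?thesis using Nsym[of x y] Nhom[of x y] NX[of y x] d by (auto simp: D_def r_def)
  qed
  have rr: "r (r d) = d" for d by (cases d) (auto simp: r_def)
  have rne: "r d \<noteq> d" if "d \<in> D" for d
    using that xN by (auto simp: D_def r_def)
  have tD: "t d \<in> D" if "d \<in> D" for d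
  proof -
    obtain x y where d: "d = (x, y)" by force
    have xy: "x \<in> X" "y \<in> N x" "card (N x) = 2" using that d by (auto simp: D_def)
    hence y: "x \<in> N y" "card (N y) = 2" "y \<in> X" using Nsym[of x y] Nhom[of x y] NX[of y x] by auto
    thus ?thesis using oth[of y x] d by (auto simp: D_def t_def)
  qed
  \<comment> \<open>Reversal conjugates walking on to walking back. This identity also makes
    \<open>t\<close> injective.\<close>
  have trt: "t (r (t d)) = r d" if "d \<in> D" for d
  proof -
    obtain x y where d: "d = (x, y)" by force
    have xy: "x \<in> X" "y \<in> N x" "card (N x) = 2" using that d by (auto simp: D_def)
    hence y: "x \<in> N y" "card (N y) = 2" "y \<in> X" using Nsym[of x y] Nhom[of x y] NX[of y x] by auto
    have "oth y (oth y x) = x" using oth[OF y(2,1)] y by (intro oth_eq) auto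
    thus ?thesis using d by (simp add: t_def r_def)
  qed
  have tinj: "inj_on t D"
    using trt rr by (metis inj_onI)
  have finD: "finite D"
    by (rule finite_subset[of _ "X \<times> X"]) (use fin in \<open>auto simp: D_def N_def\<close>)
  have tbij: "bij_betw t D D"
    unfolding bij_betw_def using endo_inj_surj[OF finD _ tinj] tinj tD by blast
  \<comment> \<open>Induction in steps of two: if \<open>k + 2\<close> steps lead from
    \<open>d\<close> to \<open>r d = t (r (t d))\<close>, cancelling one \<open>t\<close> shows that
    \<open>k\<close> steps lead from \<open>t d\<close> to its own reversal. The base cases say that
    a dart is not its reversal and that \<open>t\<close> does not turn back.\<close>
  have no_rev: "(t ^^ k) d \<noteq> r d" if "d \<in> D" for k d
    using that
  proof (induction k arbitrary: d rule: induct_nat_012)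
    case 0 thus ?case using rne by simp metis
  next
    case 1
    obtain x y where d: "d = (x, y)" by force
    have xy: "x \<in> X" "y \<in> N x" "card (N x) = 2" using 1 d by (auto simp: D_def)
    hence "x \<in> N y" "card (N y) = 2" using Nsym[of x y] Nhom[of x y] by auto
    thus ?case using oth[of y x] d by (auto simp: t_def r_def)
  next
    case (ge2 k)
    show ?case
    proof
      assume "(t ^^ Suc (Suc k)) d = r d"
      hence "t ((t ^^ k) (t d)) = t (r (t d))"
        unfolding trt[OF ge2.prems] by (simp add: funpow_swap1)
      moreover have "(t ^^ k) (t d) \<in> D" using tD ge2.prems by (intro funpow_in) auto
      ultimately have "(t ^^ k) (t d) = r (t d)"
        using tinj rD tD ge2.prems by (meson inj_onD)
      thus False using ge2.IH(1)[OF tD[OF ge2.prems]] by simp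
    qed
  qed
  define orb where "orb d = range (\<lambda>i. (t ^^ i) d)" for d
  have orb_t: "orb (t d) = orb d" if "d \<in> D" for d
  proof -
    obtain k where k: "k > 0" "(t ^^ k) d = d"
      using funpow_periodic[OF finD tbij \<open>d \<in> D\<close>] by blast
    show ?thesis
    proof
      show "orb (t d) \<subseteq> orb d"
        unfolding orb_def by (auto simp: funpow_swap1 intro: range_eqI[of _ _ "Suc _"])
      have "(t ^^ i) d \<in> orb (t d)" for i
      proof -
        have "(t ^^ i) d = (t ^^ i) ((t ^^ Suc (k - 1)) d)" using k by simp
        also have "\<dots> = (t ^^ (i + (k - 1))) (t d)"
          unfolding funpow_add by (simp add: funpow_swap1)
        finally show ?thesis unfolding orb_def by blast
      qed
      thus "orb d \<subseteq> orb (t d)" unfolding orb_def by auto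
    qed
  qed
  have tpow: "(t ^^ i) d \<in> D" if "d \<in> D" for i d
    by (rule funpow_in) (use tD that in blast)+
  have orbD: "orb d \<subseteq> D" if "d \<in> D" for d
    unfolding orb_def using tpow[OF that] by blast
  have orb_eq: "orb e = orb d" if "d \<in> D" "e \<in> orb d" for d e
  proof -
    have "orb ((t ^^ i) d) = orb d" for i
    proof (induction i)
      case (Suc i)
      thus ?case using orb_t[OF tpow[OF that(1), of i]] by simp
    qed simp
    thus ?thesis using that unfolding orb_def by auto
  qed
  have self: "d \<in> orb d" for d unfolding orb_def by (metis funpow_0 rangeI)
  \<comment> \<open>The least code of a dart in an orbit is an invariant of the orbit; comparing it
    for \<open>d\<close> and \<open>r d\<close> selects one of two mutually reversed orbits.\<close>
  define mn where "mn d = Min (prod_encode ` orb d)" for d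
  have mn: "mn d \<in> prod_encode ` orb d" if "d \<in> D" for d
    unfolding mn_def using orbD[OF that] finD self[of d] by (intro Min_in) (auto intro: finite_subset)
  have mn_ne: "mn d \<noteq> mn (r d)" if d: "d \<in> D" for d
  proof
    assume "mn d = mn (r d)"
    then obtain e where "e \<in> orb d" "e \<in> orb (r d)"
      using mn[OF d] mn[OF rD[OF d]] by (auto simp: inj_prod_encode)
    hence "r d \<in> orb d" using orb_eq[OF d] orb_eq[OF rD[OF d]] self by metis
    thus False using no_rev[OF d] unfolding orb_def by (metis rangeE)
  qed
  define A where "A = {d \<in> D. mn d < mn (r d)}"
  have Ar: "r d \<in> A \<longleftrightarrow> d \<notin> A" if "d \<in> D" for d
    using that rD[OF that] mn_ne[OF that] unfolding A_def by (auto simp: rr)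
  have At: "t d \<in> A \<longleftrightarrow> d \<in> A" if "d \<in> D" for d
  proof -
    have "orb (r (t d)) = orb (r d)"
      using orb_t[OF rD[OF tD[OF that]]] trt[OF that] by simp
    thus ?thesis using that tD[OF that] orb_t[OF that] by (simp add: A_def mn_def)
  qed
  have one: "\<exists>!y. (x, y) \<in> A" if x: "x \<in> X" "card (N x) = 2" for x
  proof -
    obtain a b where ab: "N x = {a, b}" "a \<noteq> b" using x(2) by (auto simp: card_2_iff)
    have D: "(a, x) \<in> D" "(x, a) \<in> D" "(x, b) \<in> D"
      using ab x Nsym[of x a] Nhom[of x a] NX[of a x] by (auto simp: D_def)
    have "t (a, x) = (x, b)" using oth_eq[OF x(2), of a b] ab by (auto simp: t_def)
    hence "(x, b) \<in> A \<longleftrightarrow> (a, x) \<in> A" using At[OF D(1)] by simp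
    also have "\<dots> \<longleftrightarrow> (x, a) \<notin> A" using Ar[OF D(2)] by (simp add: r_def)
    finally have "(x, b) \<in> A \<longleftrightarrow> (x, a) \<notin> A" .
    moreover have "y = a \<or> y = b" if "(x, y) \<in> A" for y
      using that ab by (auto simp: A_def D_def)
    ultimately show ?thesis by metis
  qed
  \<comment> \<open>A component with degrees 1 is a single edge whose ends are exchanged; elsewhere
    \<open>s\<close> follows the selected dart.\<close>
  define s where "s x = (if card (N x) = 2 then THE y. (x, y) \<in> A else THE y. y \<in> N x)" for x
  have s2: "(x, y) \<in> A \<longleftrightarrow> y = s x" if "x \<in> X" "card (N x) = 2" for x y
    unfolding s_def using theI'[OF one[OF that]] one[OF that] that by auto
  have s1: "N x = {s x}" if x: "x \<in> X" "card (N x) \<noteq> 2" for x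
  proof -
    have "card (N x) = 1" using deg[of x] x by (auto simp: N_def)
    then obtain z where "N x = {z}" by (auto simp: card_1_singleton_iff)
    thus ?thesis using x by (simp add: s_def)
  qed
  have sN: "s x \<in> N x" if "x \<in> X" for x
    using s1[OF that] s2[OF that, of "s x"] by (cases "card (N x) = 2") (auto simp: A_def D_def)
  have iff: "R x y \<longleftrightarrow> y = s x \<or> x = s y" if xy: "x \<in> X" "y \<in> X" for x y
  proof
    assume "R x y"
    hence y: "y \<in> N x" "x \<in> N y" using xy Nsym[of x y] by (auto simp: N_def)
    show "y = s x \<or> x = s y"
    proof (cases "card (N x) = 2")
      case True
      hence "card (N y) = 2" using Nhom[of x y] xy y by auto
      have "(x, y) \<in> D" using True xy y by (auto simp: D_def)
      from Ar[OF this] have "(y, x) \<in> A \<longleftrightarrow> (x, y) \<notin> A" by (simp add: r_def)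
      thus ?thesis using s2 xy True \<open>card (N y) = 2\<close> by blast
    qed (use s1 xy y in auto)
  next
    assume "y = s x \<or> x = s y"
    thus "R x y" using sN xy sym by (auto simp: N_def)
  qed
  have inj: "inj_on s X"
  proof (rule inj_onI)
    fix x y assume xy: "x \<in> X" "y \<in> X" "s x = s y"
    define z where "z = s x"
    have z: "z \<in> N x" "z \<in> N y" "x \<in> N z" "y \<in> N z" "z \<in> X"
      using sN[OF xy(1)] sN[OF xy(2)] xy NX[of "s x" x] Nsym[of x "s x"] Nsym[of y "s y"] by (auto simp: z_def)
    have c: "card (N x) = card (N z)" "card (N y) = card (N z)"
      using Nhom[of x z] Nhom[of y z] z xy by auto
    show "x = y"
    proof (cases "card (N z) = 2")
      case True
      hence A: "(x, z) \<in> A" "(y, z) \<in> A" using s2 xy c z_def by auto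
      hence D: "(x, z) \<in> D" "(y, z) \<in> D" by (auto simp: A_def)
      show ?thesis
      proof (rule ccontr)
        assume "x \<noteq> y"
        hence "t (x, z) = (z, y)" using oth_eq[OF True z(3,4)] by (auto simp: t_def)
        hence "(z, y) \<in> A" using At[OF D(1)] A by simp
        thus False using Ar[OF D(2)] A by (simp add: r_def)
      qed
    next
      case False
      thus ?thesis using s1[OF z(5)] z by auto
    qed
  qed
  have "bij_betw s X X"
    unfolding bij_betw_def using endo_inj_surj[OF fin _ inj] inj sN NX by blast
  thus ?thesis using that iff by blast
qed

section \<open>The signless Laplacian form\<close>

definition mat_trace :: "'a :: comm_monoid_add mat \<Rightarrow> 'a" where
  "mat_trace A = (\<Sum>i<dim_row A. A $$ (i, i))"

lemma mat_trace_mult: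
  fixes A B :: "'a :: semiring_0 mat"
  assumes "A \<in> carrier_mat n m" "B \<in> carrier_mat m n"
  shows "mat_trace (A * B) = (\<Sum>i<n. \<Sum>j<m. A $$ (i, j) * B $$ (j, i))"
  using assms by (auto simp: mat_trace_def scalar_prod_def lessThan_atLeast0 intro!: sum.cong)

lemma mat_trace_comm:
  fixes A B :: "'a :: comm_semiring_0 mat"
  assumes "A \<in> carrier_mat n m" "B \<in> carrier_mat m n"
  shows "mat_trace (A * B) = mat_trace (B * A)"
  unfolding mat_trace_mult[OF assms] mat_trace_mult[OF assms(2,1)]
  by (subst sum.swap) (simp add: mult.commute)

lemma mat_trace_similar:
  fixes B :: "'a :: comm_semiring_1 mat"
  assumes "W \<in> carrier_mat n n" "V \<in> carrier_mat n n" "B \<in> carrier_mat n n" "V * W = 1\<^sub>m n"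
  shows "mat_trace (W * B * V) = mat_trace B"
proof -
  have "mat_trace (W * B * V) = mat_trace (V * (W * B))"
    by (rule mat_trace_comm[of _ n n]) (use assms in auto)
  also have "V * (W * B) = V * W * B" by (rule assoc_mult_mat[symmetric]) (use assms in auto)
  finally show ?thesis using assms by simp
qed

definition adj :: "graph \<Rightarrow> nat \<Rightarrow> nat \<Rightarrow> real" where
  "adj G i j = (if snd G i j then 1 else 0)"

text \<open>The form is taken on functions rather than vectors, so that test vectors can be given by
  case distinctions and sums can be split over sets of vertices.\<close>

definition Q_form :: "graph \<Rightarrow> (nat \<Rightarrow> real) \<Rightarrow> real" where
  "Q_form G x = (\<Sum>i<fst G. real (degree_of G i) * (x i)\<^sup>2) + (\<Sum>i<fst G. \<Sum>j<fst G. adj G i j * x i * x j)"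

lemma adj_simple:
  assumes "simple_graph G"
  shows "adj G i j = adj G j i" "adj G i i = 0" "adj G i j \<ge> 0"
    and "adj G i j \<noteq> 0 \<Longrightarrow> i < fst G \<and> j < fst G \<and> i \<noteq> j"
  using assms by (auto simp: adj_def simple_graph_def split: if_splits)

lemma sum_adj: "(\<Sum>j<fst G. adj G i j) = real (degree_of G i)"
proof -
  have "{..<fst G} \<inter> {j. snd G i j} = {k. k < fst G \<and> snd G i k}" by auto
  thus ?thesis by (simp add: adj_def degree_of_def sum.If_cases)
qed

lemma signless_laplacian_carrier: "signless_laplacian G \<in> carrier_mat (fst G) (fst G)"
  by (simp add: signless_laplacian_def)

lemma signless_laplacian_index:
  "i < fst G \<Longrightarrow> j < fst G \<Longrightarrow>
    signless_laplacian G $$ (i, j) = adj G i j + (if i = j then real (degree_of G i) else 0)"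
  by (simp add: signless_laplacian_def adj_def)

lemma signless_laplacian_symmetric:
  "simple_graph G \<Longrightarrow> transpose_mat (signless_laplacian G) = signless_laplacian G"
  by (rule eq_matI) (auto simp: signless_laplacian_def simple_graph_def)

lemma signless_laplacian_mult_vec:
  assumes "v \<in> carrier_vec (fst G)" "i < fst G"
  shows "(signless_laplacian G *\<^sub>v v) $ i = real (degree_of G i) * v $ i + (\<Sum>j<fst G. adj G i j * v $ j)"
proof -
  have "(signless_laplacian G *\<^sub>v v) $ i = (\<Sum>j<fst G. signless_laplacian G $$ (i, j) * v $ j)"
    using assms signless_laplacian_carrier[of G] by (auto simp: scalar_prod_def lessThan_atLeast0)
  also have "\<dots> = (\<Sum>j<fst G. adj G i j * v $ j + (if i = j then real (degree_of G i) * v $ j else 0))"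
    using assms by (intro sum.cong) (auto simp: signless_laplacian_index distrib_right)
  finally show ?thesis using assms by (simp add: sum.distrib)
qed

lemma Q_form_scalar_prod:
  assumes "v \<in> carrier_vec (fst G)"
  shows "v \<bullet> (signless_laplacian G *\<^sub>v v) = Q_form G (\<lambda>i. v $ i)"
proof -
  have "v \<bullet> (signless_laplacian G *\<^sub>v v) = (\<Sum>i<fst G. v $ i * (signless_laplacian G *\<^sub>v v) $ i)"
    using signless_laplacian_carrier[of G] by (simp add: scalar_prod_def lessThan_atLeast0)
  also have "\<dots> = (\<Sum>i<fst G. real (degree_of G i) * (v $ i)\<^sup>2 + (\<Sum>j<fst G. adj G i j * v $ i * v $ j))"
    using assms
    by (intro sum.cong)
       (auto simp del: index_mult_mat_vec simp: signless_laplacian_mult_vec algebra_simps power2_eq_square sum_distrib_left)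
  finally show ?thesis by (simp add: Q_form_def sum.distrib)
qed

lemma Q_form_cong: "(\<And>i. i < fst G \<Longrightarrow> x i = y i) \<Longrightarrow> Q_form G x = Q_form G y"
  by (simp add: Q_form_def)

text \<open>Transports bounds from \<open>G\<close> to \<open>H\<close>: a bound of the form by the
  squared norm that holds on all vectors for \<open>G\<close> holds on all vectors for
  \<open>H\<close>, and one that holds where the coordinate \<open>i\<close> vanishes holds for
  \<open>H\<close> on the hyperplane normal to row \<open>i\<close> of \<open>w\<close>.\<close>

lemma cospectral_Q_form:
  assumes G: "simple_graph G" and H: "simple_graph H" and n: "fst H = fst G"
    and cp: "char_poly (signless_laplacian H) = char_poly (signless_laplacian G)"
  obtains w :: "nat \<Rightarrow> nat \<Rightarrow> real"
  where "\<And>x. Q_form H x = Q_form G (\<lambda>i. \<Sum>j<fst G. w i j * x j)"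
    and "\<And>x. (\<Sum>i<fst G. (\<Sum>j<fst G. w i j * x j)\<^sup>2) = (\<Sum>i<fst G. (x i)\<^sup>2)"
proof -
  define n where "n = fst G"
  let ?G = "signless_laplacian G" and ?H = "signless_laplacian H"
  have cG: "?G \<in> carrier_mat n n" and cH: "?H \<in> carrier_mat n n"
    using signless_laplacian_carrier[of G] signless_laplacian_carrier[of H] n by (simp_all add: n_def)
  obtain W where W: "W \<in> carrier_mat n n" "transpose_mat W * W = 1\<^sub>m n" "W * transpose_mat W = 1\<^sub>m n"
    "?H = W * ?G * transpose_mat W"
    using cospectral_symmetric_orthogonally_similar
      [OF cH signless_laplacian_symmetric[OF H] cG signless_laplacian_symmetric[OF G] cp] by blast
  define w where "w i j = W $$ (j, i)" for i j
  have Wt: "transpose_mat W \<in> carrier_mat n n" using W by auto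
  have prod: "(W *\<^sub>v a) \<bullet> b = a \<bullet> (transpose_mat W *\<^sub>v b)"
    if "a \<in> carrier_vec n" "b \<in> carrier_vec n" for a b
    using transpose_vec_mult_scalar[OF Wt that(2,1)] that W(1) comm_scalar_prod[of b n "W *\<^sub>v a"]
      comm_scalar_prod[of a n "transpose_mat W *\<^sub>v b"] by simp
  have wx: "(transpose_mat W *\<^sub>v vec n x) $ i = (\<Sum>j<n. w i j * x j)" if "i < n" for x i
    using W that by (auto simp: w_def scalar_prod_def lessThan_atLeast0)
  have "Q_form H x = Q_form G (\<lambda>i. \<Sum>j<n. w i j * x j)" for x
  proof -
    let ?v = "vec n x"
    have v: "?v \<in> carrier_vec n" by simp
    have "Q_form H x = Q_form H (\<lambda>i. ?v $ i)"
      by (rule Q_form_cong) (simp add: n n_def)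
    also have "\<dots> = ?v \<bullet> (?H *\<^sub>v ?v)"
      by (rule Q_form_scalar_prod[symmetric]) (simp add: n n_def)
    also have "?H *\<^sub>v ?v = W *\<^sub>v (?G *\<^sub>v (transpose_mat W *\<^sub>v ?v))"
      unfolding W(4) using W(1) Wt cG by (simp add: assoc_mult_mat_vec[of _ n n _ n])
    also have "?v \<bullet> \<dots> = \<dots> \<bullet> ?v"
      by (rule comm_scalar_prod[of _ n]) (use W(1) Wt cG in \<open>auto intro!: mult_mat_vec_carrier\<close>)
    also have "\<dots> = (?G *\<^sub>v (transpose_mat W *\<^sub>v ?v)) \<bullet> (transpose_mat W *\<^sub>v ?v)"
      by (rule prod) (use W(1) cG in auto)
    also have "\<dots> = (transpose_mat W *\<^sub>v ?v) \<bullet> (?G *\<^sub>v (transpose_mat W *\<^sub>v ?v))"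
      by (rule comm_scalar_prod[of _ n]) (use W(1) cG in auto)
    also have "\<dots> = Q_form G (\<lambda>i. (transpose_mat W *\<^sub>v ?v) $ i)"
      by (rule Q_form_scalar_prod) (use W(1) in \<open>auto simp: n_def\<close>)
    also have "\<dots> = Q_form G (\<lambda>i. \<Sum>j<n. w i j * x j)"
      by (rule Q_form_cong) (use wx in \<open>auto simp: n_def\<close>)
    finally show ?thesis .
  qed
  moreover have "(\<Sum>i<n. (\<Sum>j<n. w i j * x j)\<^sup>2) = (\<Sum>i<n. (x i)\<^sup>2)" for x
  proof -
    let ?v = "vec n x"
    let ?u = "transpose_mat W *\<^sub>v ?v"
    have u: "?u \<in> carrier_vec n" using W(1) by auto
    have "(\<Sum>i<n. (\<Sum>j<n. w i j * x j)\<^sup>2) = ?u \<bullet> ?u"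
      using carrier_matD[OF W(1)] by (simp add: scalar_prod_def lessThan_atLeast0 wx[unfolded lessThan_atLeast0] power2_eq_square
          del: index_mult_mat_vec)
    also have "\<dots> = (W *\<^sub>v ?u) \<bullet> ?v" using prod[OF u, of ?v] by simp
    also have "W *\<^sub>v ?u = ?v"
      using W Wt assoc_mult_mat_vec[OF W(1) Wt, of ?v] by simp
    also have "?v \<bullet> ?v = (\<Sum>i<n. (x i)\<^sup>2)"
      by (simp add: scalar_prod_def lessThan_atLeast0 power2_eq_square)
    finally show ?thesis .
  qed
  ultimately show ?thesis using that unfolding n_def by blast
qed

lemma mat_trace_signless_laplacian:
  assumes "simple_graph G"
  shows "mat_trace (signless_laplacian G) = (\<Sum>i<fst G. real (degree_of G i))"
  using signless_laplacian_carrier[of G] adj_simple(2)[OF assms]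
  by (simp add: mat_trace_def signless_laplacian_index)

text \<open>The linear degree term comes from the off-diagonal entries: row \<open>i\<close>
  contains \<open>degree_of G i\<close> ones, each equal to its square.\<close>

lemma mat_trace_signless_laplacian_square:
  assumes "simple_graph G"
  shows "mat_trace (signless_laplacian G * signless_laplacian G) =
    (\<Sum>i<fst G. (real (degree_of G i))\<^sup>2 + real (degree_of G i))"
proof -
  have "(\<Sum>j<fst G. signless_laplacian G $$ (i, j) * signless_laplacian G $$ (j, i)) =
    (real (degree_of G i))\<^sup>2 + real (degree_of G i)" if i: "i < fst G" for i
  proof -
    have "(\<Sum>j<fst G. signless_laplacian G $$ (i, j) * signless_laplacian G $$ (j, i)) =
      (\<Sum>j<fst G. adj G i j + (if i = j then (real (degree_of G i))\<^sup>2 else 0))"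
      using i adj_simple(1,2)[OF assms]
      by (intro sum.cong) (auto simp: signless_laplacian_index power2_eq_square adj_def)
    thus ?thesis using i by (simp add: sum.distrib sum_adj)
  qed
  thus ?thesis
    unfolding mat_trace_mult[OF signless_laplacian_carrier signless_laplacian_carrier] by simp
qed

text \<open>The traces of Q and of its square are invariant under similarity; subtracting the first
  from the second isolates the squared degrees.\<close>

lemma cospectral_degree_sums:
  assumes G: "simple_graph G" and H: "simple_graph H" and n: "fst H = fst G"
    and cp: "char_poly (signless_laplacian H) = char_poly (signless_laplacian G)"
  shows "(\<Sum>i<fst G. real (degree_of H i)) = (\<Sum>i<fst G. real (degree_of G i))"
    and "(\<Sum>i<fst G. (real (degree_of H i))\<^sup>2) = (\<Sum>i<fst G. (real (degree_of G i))\<^sup>2)"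
proof -
  define n where "n = fst G"
  let ?G = "signless_laplacian G" and ?H = "signless_laplacian H"
  have cG: "?G \<in> carrier_mat n n" and cH: "?H \<in> carrier_mat n n"
    using signless_laplacian_carrier[of G] signless_laplacian_carrier[of H] n by (simp_all add: n_def)
  obtain W where W: "W \<in> carrier_mat n n" "transpose_mat W * W = 1\<^sub>m n" "W * transpose_mat W = 1\<^sub>m n"
    "?H = W * ?G * transpose_mat W"
    using cospectral_symmetric_orthogonally_similar
      [OF cH signless_laplacian_symmetric[OF H] cG signless_laplacian_symmetric[OF G] cp] by blast
  have Wt: "transpose_mat W \<in> carrier_mat n n" using W by auto
  have "mat_trace ?H = mat_trace ?G"
    unfolding W(4) by (rule mat_trace_similar) (use W Wt cG in auto)
  thus 1: "(\<Sum>i<fst G. real (degree_of H i)) = (\<Sum>i<fst G. real (degree_of G i))"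
    unfolding mat_trace_signless_laplacian[OF H] mat_trace_signless_laplacian[OF G] n .
  have "?H * ?H = W * (?G * ((transpose_mat W * W) * ?G)) * transpose_mat W"
    unfolding W(4) using W(1) Wt cG by (simp add: assoc_mult_mat[of _ n n _ n _ n])
  also have "\<dots> = W * (?G * ?G) * transpose_mat W"
    unfolding W(2) using cG by simp
  finally have "mat_trace (?H * ?H) = mat_trace (?G * ?G)"
    using mat_trace_similar[OF W(1) Wt _ W(2), of "?G * ?G"] cG by simp
  thus "(\<Sum>i<fst G. (real (degree_of H i))\<^sup>2) = (\<Sum>i<fst G. (real (degree_of G i))\<^sup>2)"
    using 1 unfolding mat_trace_signless_laplacian_square[OF H] mat_trace_signless_laplacian_square[OF G] n
    by (simp add: sum.distrib)
qed

section \<open>Graphs with a dominating vertex\<close>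

text \<open>The stage at which a mate is known only by its degree sequence. Degrees count the edge
  to the hub, so a base vertex has 1 or 2 neighbours in the base, and both cases may still occur in
  one component, as in a path.\<close>

locale hub_graph =
  fixes G :: graph and u :: nat
  assumes simple: "simple_graph G"
    and u: "u < fst G"
    and hub: "\<And>i. i < fst G \<Longrightarrow> i \<noteq> u \<Longrightarrow> snd G u i"
    and deg: "\<And>i. i < fst G \<Longrightarrow> i \<noteq> u \<Longrightarrow> degree_of G i = 2 \<or> degree_of G i = 3"
begin

abbreviation "n \<equiv> fst G"
abbreviation "d i \<equiv> real (degree_of G i)"
abbreviation "a \<equiv> adj G"
definition "N = {..<n} - {u}"
definition "num_deg3 = card {i \<in> N. degree_of G i = 3}"
definition "num_deg2 = card {i \<in> N. degree_of G i = 2}"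

lemmas sym = adj_simple(1)[OF simple] and irr = adj_simple(2)[OF simple]

lemma finite_N [simp]: "finite N" by (simp add: N_def)

lemma sum_split: "(\<Sum>i<n. f i) = f u + (\<Sum>i\<in>N. f i)" for f :: "nat \<Rightarrow> real"
  unfolding N_def using u by (simp add: sum.remove)

lemma real_card_N: "real (card N) = real n - 1"
  unfolding N_def using u by auto

lemma a_hub: "i \<in> N \<Longrightarrow> a u i = 1" "i \<in> N \<Longrightarrow> a i u = 1"
  using hub[of i] sym[of i u] by (auto simp: N_def adj_def)

lemma deg_hub: "d u = real n - 1"
  unfolding sum_adj[symmetric] sum_split using irr[of u] real_card_N by (simp add: a_hub)

lemma sum_adj_N: "i \<in> N \<Longrightarrow> (\<Sum>j\<in>N. a i j) = d i - 1"
  using sum_adj[of G i] unfolding sum_split by (simp add: a_hub)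

lemma sum_adj_N_right: "j \<in> N \<Longrightarrow> (\<Sum>i\<in>N. a i j) = d j - 1"
  using sum_adj_N[of j] by (simp add: sym)

lemma deg_N: "i \<in> N \<Longrightarrow> d i = 2 \<or> d i = 3"
  using deg[of i] by (auto simp: N_def)

lemma sum_deg_N: "(\<Sum>i\<in>N. f (degree_of G i)) = real num_deg3 * f 3 + real num_deg2 * f 2" for f :: "nat \<Rightarrow> real"
proof -
  have N: "N = {i \<in> N. degree_of G i = 3} \<union> {i \<in> N. degree_of G i = 2}"
    using deg by (auto simp: N_def)
  have "(\<Sum>i\<in>N. f (degree_of G i)) =
    (\<Sum>i\<in>{i \<in> N. degree_of G i = 3}. f (degree_of G i)) + (\<Sum>i\<in>{i \<in> N. degree_of G i = 2}. f (degree_of G i))"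
    by (subst N, rule sum.union_disjoint) auto
  thus ?thesis by (simp add: num_deg3_def num_deg2_def)
qed

lemma num_deg_sum: "num_deg3 + num_deg2 + 1 = n"
proof -
  have "real (card N) = real num_deg3 + real num_deg2" using sum_deg_N[of "\<lambda>_. 1"] by simp
  thus ?thesis using real_card_N u by linarith
qed

text \<open>Each edge term is at most half the sum of the two squares, so the base edges cost at
  most \<open>d i - 1\<close> at \<open>i\<close> on top of the diagonal \<open>d i\<close>, and
  \<open>2 * d i - 1\<close> is at most 5.\<close>

lemma Q_form_le_five:
  assumes "x u = 0"
  shows "Q_form G x \<le> 5 * (\<Sum>i<n. (x i)\<^sup>2)"
proof -
  have "(\<Sum>i\<in>N. \<Sum>j\<in>N. a i j * x i * x j) \<le> (\<Sum>i\<in>N. \<Sum>j\<in>N. a i j * ((x i)\<^sup>2 / 2) + a i j * ((x j)\<^sup>2 / 2))"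
  proof (intro sum_mono)
    fix i j
    have "x i * x j \<le> (x i)\<^sup>2 / 2 + (x j)\<^sup>2 / 2"
      using zero_le_power2[of "x i - x j"] by (simp add: power2_diff)
    from mult_left_mono[OF this adj_simple(3)[OF simple]]
    show "a i j * x i * x j \<le> a i j * ((x i)\<^sup>2 / 2) + a i j * ((x j)\<^sup>2 / 2)"
      by (simp add: algebra_simps)
  qed
  also have "\<dots> = (\<Sum>i\<in>N. (\<Sum>j\<in>N. a i j) * ((x i)\<^sup>2 / 2)) + (\<Sum>j\<in>N. (\<Sum>i\<in>N. a i j) * ((x j)\<^sup>2 / 2))"
    unfolding sum.distrib sum_distrib_right
    by (rule arg_cong2[of _ _ _ _ "(+)", OF refl]) (rule sum.swap)
  also have "\<dots> = (\<Sum>i\<in>N. (d i - 1) * (x i)\<^sup>2)"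
    by (simp add: sum_adj_N sum_adj_N_right sum.distrib[symmetric])
  finally have "Q_form G x \<le> (\<Sum>i\<in>N. d i * (x i)\<^sup>2) + (\<Sum>i\<in>N. (d i - 1) * (x i)\<^sup>2)"
    unfolding Q_form_def sum_split using assms by simp
  also have "\<dots> = (\<Sum>i\<in>N. (2 * d i - 1) * (x i)\<^sup>2)"
    by (simp add: sum.distrib[symmetric] algebra_simps)
  also have "\<dots> \<le> (\<Sum>i\<in>N. 5 * (x i)\<^sup>2)"
    by (intro sum_mono mult_right_mono) (use deg_N in force)+
  also have "\<dots> = 5 * (\<Sum>i<n. (x i)\<^sup>2)" unfolding sum_split using assms by (simp add: sum_distrib_left)
  finally show ?thesis .
qed

text \<open>Candidate eigenvector, scaled to 1 at the hub. If its values are constant along base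
  edges, the value z at a base vertex of degree d must satisfy l z = d z + 1 + (d - 1) z, which
  gives the quotient.\<close>

definition weight :: "real \<Rightarrow> nat \<Rightarrow> real" where
  "weight l i = (if i = u then 1 else 1 / (l + 1 - 2 * d i))"

lemma exists_large_root:
  assumes "n \<ge> 8"
  obtains l where "l > real n" "l = real n - 1 + (\<Sum>i\<in>N. weight l i)"
proof -
  define g where "g l = l - (real n - 1) - (\<Sum>i\<in>N. weight l i)" for l
  have den: "1 \<le> l + 1 - 2 * d i" if "i \<in> N" "l \<ge> real n" for i l
    using deg_N[OF that(1)] that(2) assms by auto
  have iu: "i \<in> N \<Longrightarrow> i \<noteq> u" for i by (simp add: N_def)
  have "(real n - 1) * (1 / (real n - 3)) = (\<Sum>i\<in>N. 1 / (real n - 3))"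
    using real_card_N by simp
  also have "\<dots> \<le> (\<Sum>i\<in>N. weight (real n) i)"
  proof (rule sum_mono)
    fix i assume i: "i \<in> N"
    have "0 < real n + 1 - 2 * d i" using den[OF i, of "real n"] by simp
    moreover have "real n + 1 - 2 * d i \<le> real n - 3" using deg_N[OF i] by auto
    ultimately show "1 / (real n - 3) \<le> weight (real n) i"
      using iu[OF i] by (simp add: weight_def frac_le)
  qed
  finally have "1 < (\<Sum>i\<in>N. weight (real n) i)"
    by (rule less_le_trans[rotated]) (use assms in \<open>simp add: field_simps\<close>)
  hence g1: "g (real n) < 0" unfolding g_def by simp
  have "(\<Sum>i\<in>N. weight (2 * real n) i) \<le> (\<Sum>i\<in>N. 1)"
  proof (rule sum_mono)
    fix i assume i: "i \<in> N"
    show "weight (2 * real n) i \<le> 1" using den[OF i, of "2 * real n"] iu[OF i] by (simp add: weight_def)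
  qed
  hence g2: "g (2 * real n) > 0" unfolding g_def using real_card_N by simp
  have "continuous_on {real n..2 * real n} g"
  proof -
    have "continuous_on {real n..2 * real n} (\<lambda>l. weight l i)" if i: "i \<in> N" for i
    proof -
      have "\<forall>l\<in>{real n..2 * real n}. l + 1 - 2 * d i \<noteq> 0"
      proof
        fix l assume "l \<in> {real n..2 * real n}"
        thus "l + 1 - 2 * d i \<noteq> 0" using den[OF i, of l] by simp
      qed
      hence "continuous_on {real n..2 * real n} (\<lambda>l. 1 / (l + 1 - 2 * d i))"
        by (intro continuous_intros)
      thus ?thesis using iu[OF i] by (simp add: weight_def)
    qed
    thus ?thesis unfolding g_def by (intro continuous_intros) auto
  qed
  then obtain l where l: "real n \<le> l" "g l = 0"
    using IVT'[of g "real n" 0 "2 * real n"] g1 g2 by auto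
  have "l \<noteq> real n" using g1 l by auto
  thus ?thesis using that[of l] l unfolding g_def by auto
qed

text \<open>Only the two degree counts enter, so a hub graph of the same order and counts shares the
  root \<open>l\<close> and, later, the factor that belongs to the apex.\<close>

lemma sum_weight: "(\<Sum>i\<in>N. weight l i) = real num_deg3 / (l - 5) + real num_deg2 / (l - 3)"
proof -
  have "(\<Sum>i\<in>N. weight l i) = (\<Sum>i\<in>N. (\<lambda>k. 1 / (l + 1 - 2 * real k)) (degree_of G i))"
    by (rule sum.cong) (auto simp: weight_def N_def)
  also have "\<dots> = real num_deg3 * (1 / (l + 1 - 2 * real 3)) + real num_deg2 * (1 / (l + 1 - 2 * real 2))"
    by (rule sum_deg_N)
  finally show ?thesis by simp
qed

end

locale cone_graph = hub_graph +
  assumes hom: "\<And>i j. i \<noteq> u \<Longrightarrow> j \<noteq> u \<Longrightarrow> snd G i j \<Longrightarrow> degree_of G i = degree_of G j"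
begin

lemma a_hom: "i \<in> N \<Longrightarrow> j \<in> N \<Longrightarrow> a i j * f (degree_of G i) = a i j * f (degree_of G j)" for f :: "nat \<Rightarrow> real"
  using hom[of i j] by (auto simp: N_def adj_def)

lemma sum_adj_weight:
  assumes "i \<in> N"
  shows "(\<Sum>j\<in>N. a i j * weight l j) = (d i - 1) * weight l i"
proof -
  have "(\<Sum>j\<in>N. a i j * weight l j) = (\<Sum>j\<in>N. a i j * weight l i)"
  proof (rule sum.cong[OF refl])
    fix j assume "j \<in> N"
    thus "a i j * weight l j = a i j * weight l i"
      using a_hom[OF assms, of j "\<lambda>k. 1 / (l + 1 - 2 * real k)"] assms by (auto simp: weight_def N_def)
  qed
  thus ?thesis using sum_adj_N[OF assms] by (simp add: sum_distrib_right[symmetric])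
qed

text \<open>With weight w = 1 / (d - 1) on the edges of degree d off the hub, the excess of the form over the
  squared norm is a sum of squares up to a multiple of the square of the value at the hub.\<close>

lemma Q_form_ge_norm:
  assumes "n \<ge> 3"
  shows "(\<Sum>i<n. (x i)\<^sup>2) \<le> Q_form G x"
proof -
  define w where "w i = 1 / (d i - 1)" for i
  have w: "0 < w i" "w i \<le> 1" "(d i - 1) * w i = 1" if "i \<in> N" for i
    using deg_N[OF that] by (auto simp: w_def)
  have aw: "a i j * w i = a i j * w j" if "i \<in> N" "j \<in> N" for i j
    using a_hom[OF that, of "\<lambda>k. 1 / (real k - 1)"] by (simp add: w_def)
  have "0 \<le> (\<Sum>i\<in>N. \<Sum>j\<in>N. a i j * (w i * (x u)\<^sup>2 + 2 * w i * x u * (x i + x j) + (x i + x j)\<^sup>2))"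
  proof (intro sum_nonneg mult_nonneg_nonneg adj_simple(3)[OF simple])
    fix i j assume "i \<in> N"
    \<comment> \<open>Completing the square; the remainder is nonnegative because \<open>w i\<close>
      lies between 0 and 1.\<close>
    have "w i * (x u)\<^sup>2 + 2 * w i * x u * (x i + x j) + (x i + x j)\<^sup>2 =
      (x i + x j + w i * x u)\<^sup>2 + w i * (1 - w i) * (x u)\<^sup>2" by (simp add: power2_eq_square algebra_simps)
    also have "\<dots> \<ge> 0" using w[OF \<open>i \<in> N\<close>] by (intro add_nonneg_nonneg mult_nonneg_nonneg) auto
    finally show "0 \<le> w i * (x u)\<^sup>2 + 2 * w i * x u * (x i + x j) + (x i + x j)\<^sup>2" .
  qed
  also have "\<dots> = (\<Sum>i\<in>N. \<Sum>j\<in>N. a i j * (w i * (x u)\<^sup>2 + 2 * w i * x u * x i + (x i)\<^sup>2))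
     + (\<Sum>i\<in>N. \<Sum>j\<in>N. a i j * (2 * w i * x u * x j + (x j)\<^sup>2))
     + 2 * (\<Sum>i\<in>N. \<Sum>j\<in>N. a i j * x i * x j)"
  proof -
    have "(\<Sum>i\<in>N. \<Sum>j\<in>N. a i j * (w i * (x u)\<^sup>2 + 2 * w i * x u * (x i + x j) + (x i + x j)\<^sup>2)) =
      (\<Sum>i\<in>N. \<Sum>j\<in>N. a i j * (w i * (x u)\<^sup>2 + 2 * w i * x u * x i + (x i)\<^sup>2)
        + a i j * (2 * w i * x u * x j + (x j)\<^sup>2) + 2 * (a i j * x i * x j))"
      by (intro sum.cong refl) (simp add: power2_eq_square algebra_simps)
    thus ?thesis by (simp only: sum.distrib sum_distrib_left)
  qed
  also have "(\<Sum>i\<in>N. \<Sum>j\<in>N. a i j * (w i * (x u)\<^sup>2 + 2 * w i * x u * x i + (x i)\<^sup>2)) =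
    (\<Sum>i\<in>N. (d i - 1) * (w i * (x u)\<^sup>2 + 2 * w i * x u * x i + (x i)\<^sup>2))"
    by (simp add: sum_distrib_right[symmetric] sum_adj_N)
  also have "\<dots> = (\<Sum>i\<in>N. (x u)\<^sup>2 + 2 * x u * x i + (d i - 1) * (x i)\<^sup>2)"
  proof (rule sum.cong[OF refl])
    fix i assume i: "i \<in> N"
    have "(d i - 1) * (w i * (x u)\<^sup>2 + 2 * w i * x u * x i + (x i)\<^sup>2) =
      ((d i - 1) * w i) * ((x u)\<^sup>2 + 2 * x u * x i) + (d i - 1) * (x i)\<^sup>2" by (simp add: algebra_simps)
    thus "(d i - 1) * (w i * (x u)\<^sup>2 + 2 * w i * x u * x i + (x i)\<^sup>2) =
      (x u)\<^sup>2 + 2 * x u * x i + (d i - 1) * (x i)\<^sup>2" using w(3)[OF i] by simp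
  qed
  also have "(\<Sum>i\<in>N. \<Sum>j\<in>N. a i j * (2 * w i * x u * x j + (x j)\<^sup>2)) =
    (\<Sum>j\<in>N. \<Sum>i\<in>N. a i j * (2 * w i * x u * x j + (x j)\<^sup>2))" by (rule sum.swap)
  also have "\<dots> = (\<Sum>j\<in>N. \<Sum>i\<in>N. a i j * (2 * w j * x u * x j + (x j)\<^sup>2))"
  proof (intro sum.cong refl)
    fix i j assume ij: "j \<in> N" "i \<in> N"
    show "a i j * (2 * w i * x u * x j + (x j)\<^sup>2) = a i j * (2 * w j * x u * x j + (x j)\<^sup>2)"
      using arg_cong[OF aw[OF ij(2,1)], of "\<lambda>z. z * (2 * x u * x j)"] by (simp add: algebra_simps)
  qed
  also have "\<dots> = (\<Sum>j\<in>N. (d j - 1) * (2 * w j * x u * x j + (x j)\<^sup>2))"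
    by (simp add: sum_distrib_right[symmetric] sum_adj_N_right)
  also have "\<dots> = (\<Sum>j\<in>N. 2 * x u * x j + (d j - 1) * (x j)\<^sup>2)"
  proof (rule sum.cong[OF refl])
    fix i assume i: "i \<in> N"
    have "(d i - 1) * (2 * w i * x u * x i + (x i)\<^sup>2) =
      ((d i - 1) * w i) * (2 * x u * x i) + (d i - 1) * (x i)\<^sup>2" by (simp add: algebra_simps)
    thus "(d i - 1) * (2 * w i * x u * x i + (x i)\<^sup>2) = 2 * x u * x i + (d i - 1) * (x i)\<^sup>2"
      using w(3)[OF i] by simp
  qed
  finally have *: "0 \<le> (real n - 1) * (x u)\<^sup>2 + 4 * x u * (\<Sum>i\<in>N. x i) + 2 * (\<Sum>i\<in>N. (d i - 1) * (x i)\<^sup>2)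
    + 2 * (\<Sum>i\<in>N. \<Sum>j\<in>N. a i j * x i * x j)"
  proof -
    have s1: "(\<Sum>i\<in>N. (x u)\<^sup>2 + 2 * x u * x i + (d i - 1) * (x i)\<^sup>2) =
      (real n - 1) * (x u)\<^sup>2 + 2 * x u * (\<Sum>i\<in>N. x i) + (\<Sum>i\<in>N. (d i - 1) * (x i)\<^sup>2)"
      unfolding sum.distrib sum_distrib_left[symmetric] using real_card_N by simp
    have s2: "(\<Sum>j\<in>N. 2 * x u * x j + (d j - 1) * (x j)\<^sup>2) =
      2 * x u * (\<Sum>i\<in>N. x i) + (\<Sum>i\<in>N. (d i - 1) * (x i)\<^sup>2)"
      unfolding sum.distrib sum_distrib_left[symmetric] by simp
    assume "0 \<le> (\<Sum>i\<in>N. (x u)\<^sup>2 + 2 * x u * x i + (d i - 1) * (x i)\<^sup>2)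
      + (\<Sum>j\<in>N. 2 * x u * x j + (d j - 1) * (x j)\<^sup>2) + 2 * (\<Sum>i\<in>N. \<Sum>j\<in>N. a i j * x i * x j)"
    thus ?thesis unfolding s1 s2 by simp
  qed
  have "Q_form G x - (\<Sum>i<n. (x i)\<^sup>2) = (real n - 2) * (x u)\<^sup>2 + 2 * x u * (\<Sum>i\<in>N. x i)
    + (\<Sum>i\<in>N. (d i - 1) * (x i)\<^sup>2) + (\<Sum>i\<in>N. \<Sum>j\<in>N. a i j * x i * x j)"
  proof -
    have s1: "(\<Sum>i\<in>N. (d i - 1) * (x i)\<^sup>2) = (\<Sum>i\<in>N. d i * (x i)\<^sup>2) - (\<Sum>i\<in>N. (x i)\<^sup>2)"
      by (simp add: left_diff_distrib sum_subtractf)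
    have s2: "(\<Sum>j\<in>N. a u j * x u * x j) = x u * (\<Sum>i\<in>N. x i)"
      by (simp add: a_hub sum_distrib_left)
    have s3: "(\<Sum>i\<in>N. a i u * x i * x u + (\<Sum>j\<in>N. a i j * x i * x j)) =
      x u * (\<Sum>i\<in>N. x i) + (\<Sum>i\<in>N. \<Sum>j\<in>N. a i j * x i * x j)"
      by (simp add: a_hub sum_distrib_left sum.distrib mult.commute)
    show ?thesis
      unfolding Q_form_def sum_split s1 s2 s3 deg_hub using irr[of u] by (simp add: algebra_simps)
  qed
  \<comment> \<open>Half of the inequality \<open>*\<close> uses only (n - 1) / 2 of the n - 2
    squares available at the hub; this is where \<open>n \<ge> 3\<close> enters.\<close>
  moreover have "(real n - 2) * (x u)\<^sup>2 \<ge> (real n - 1) * (x u)\<^sup>2 / 2"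
  proof -
    have "(real n - 1) / 2 \<le> real n - 2" using assms by simp
    from mult_right_mono[OF this, of "(x u)\<^sup>2"] show ?thesis by simp
  qed
  ultimately show ?thesis using * by argo
qed

lemma weight_eigenvector:
  assumes l: "l > 5" "l = real n - 1 + (\<Sum>i\<in>N. weight l i)"
  shows "eigenvalue (signless_laplacian G) l"
proof -
  let ?v = "vec n (weight l)"
  have "signless_laplacian G *\<^sub>v ?v = l \<cdot>\<^sub>v ?v"
  proof (rule eq_vecI)
    fix i assume "i < dim_vec (l \<cdot>\<^sub>v ?v)"
    hence i: "i < n" by simp
    have "(signless_laplacian G *\<^sub>v ?v) $ i = d i * weight l i + (\<Sum>j<n. a i j * weight l j)"
      using i by (subst signless_laplacian_mult_vec) auto
    also have "\<dots> = l * weight l i"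
    proof (cases "i = u")
      case True
      have "weight l u = 1" by (simp add: weight_def)
      thus ?thesis using l(2) irr[of u] unfolding sum_split True by (simp add: a_hub deg_hub)
    next
      case False
      hence iN: "i \<in> N" using i by (simp add: N_def)
      have "d i * weight l i + (\<Sum>j<n. a i j * weight l j) = 1 + (2 * d i - 1) * weight l i"
        unfolding sum_split sum_adj_weight[OF iN] using iN by (simp add: a_hub weight_def[of l u] algebra_simps)
      moreover have "(l + 1 - 2 * d i) * weight l i = 1"
        using deg_N[OF iN] l(1) False by (auto simp: weight_def)
      ultimately show ?thesis by (simp add: algebra_simps)
    qed
    finally show "(signless_laplacian G *\<^sub>v ?v) $ i = (l \<cdot>\<^sub>v ?v) $ i" using i by simp
  qed (use signless_laplacian_carrier[of G] in auto)
  moreover have "?v \<noteq> 0\<^sub>v n"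
  proof
    assume "?v = 0\<^sub>v n"
    from arg_cong[OF this, of "\<lambda>w. w $ u"] show False using u by (simp add: weight_def)
  qed
  ultimately show ?thesis
    using signless_laplacian_carrier[of G] unfolding eigenvalue_def eigenvector_def
    by (intro exI[of _ ?v]) auto
qed

end

section \<open>The structure of a cospectral mate\<close>

lemma eigenvalue_signless_laplacianE:
  assumes "eigenvalue (signless_laplacian G) l"
  obtains y where "\<exists>i<fst G. y i \<noteq> 0"
    and "\<And>i. i < fst G \<Longrightarrow> l * y i = real (degree_of G i) * y i + (\<Sum>j<fst G. adj G i j * y j)"
proof -
  obtain v where v: "v \<in> carrier_vec (fst G)" "v \<noteq> 0\<^sub>v (fst G)" "signless_laplacian G *\<^sub>v v = l \<cdot>\<^sub>v v"
    using assms signless_laplacian_carrier[of G] by (auto simp: eigenvalue_def eigenvector_def)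
  have "\<exists>i<fst G. v $ i \<noteq> 0" using v(1,2) by (metis carrier_vecD index_zero_vec(1) eq_vecI zero_carrier_vec)
  moreover have "l * v $ i = real (degree_of G i) * v $ i + (\<Sum>j<fst G. adj G i j * v $ j)" if "i < fst G" for i
    using signless_laplacian_mult_vec[OF v(1) that] arg_cong[OF v(3), of "\<lambda>w. w $ i"] that v(1) by simp
  ultimately show ?thesis using that[of "\<lambda>i. v $ i"] by blast
qed

text \<open>Take the row of an eigenvector entry of largest modulus: its row sum is twice the
  degree.\<close>

lemma eigenvalue_le_twice_degree:
  assumes "simple_graph G" "eigenvalue (signless_laplacian G) l"
  obtains i where "i < fst G" "l \<le> 2 * real (degree_of G i)"
proof -
  obtain y where y: "\<exists>i<fst G. y i \<noteq> 0"
    "\<And>i. i < fst G \<Longrightarrow> l * y i = real (degree_of G i) * y i + (\<Sum>j<fst G. adj G i j * y j)"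
    using eigenvalue_signless_laplacianE[OF assms(2)] by blast
  obtain k where k: "k < fst G" "y k \<noteq> 0" using y(1) by blast
  define m where "m = Max ((\<lambda>i. \<bar>y i\<bar>) ` {..<fst G})"
  have "m \<in> (\<lambda>i. \<bar>y i\<bar>) ` {..<fst G}" unfolding m_def using k by (intro Max_in) auto
  then obtain i where i: "i < fst G" "m = \<bar>y i\<bar>" by auto
  have le: "\<bar>y j\<bar> \<le> m" if "j < fst G" for j unfolding m_def using that by (intro Max_ge) auto
  have "m > 0" using le[OF k(1)] k by auto
  have "l * m \<le> \<bar>l * y i\<bar>" by (simp add: i abs_mult mult_right_mono)
  also have "\<dots> \<le> \<bar>real (degree_of G i) * y i\<bar> + \<bar>\<Sum>j<fst G. adj G i j * y j\<bar>"
    unfolding y(2)[OF i(1)] by (rule abs_triangle_ineq)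
  also have "\<bar>\<Sum>j<fst G. adj G i j * y j\<bar> \<le> (\<Sum>j<fst G. \<bar>adj G i j * y j\<bar>)" by (rule sum_abs)
  also have "\<dots> \<le> (\<Sum>j<fst G. adj G i j * m)"
    using le by (intro sum_mono) (auto simp: adj_def)
  also have "\<dots> = real (degree_of G i) * m" by (simp add: sum_distrib_right[symmetric] sum_adj)
  finally have "l * m \<le> (2 * real (degree_of G i)) * m" by (simp add: abs_mult i algebra_simps)
  hence "l \<le> 2 * real (degree_of G i)" using \<open>m > 0\<close> by simp
  thus ?thesis using that i by blast
qed

lemma Q_form_support:
  assumes "T \<subseteq> {..<fst G}" "\<And>i. i \<notin> T \<Longrightarrow> x i = 0"
  shows "Q_form G x = (\<Sum>i\<in>T. real (degree_of G i) * (x i)\<^sup>2) + (\<Sum>i\<in>T. \<Sum>j\<in>T. adj G i j * x i * x j)"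
proof -
  have "(\<Sum>i<fst G. real (degree_of G i) * (x i)\<^sup>2) = (\<Sum>i\<in>T. real (degree_of G i) * (x i)\<^sup>2)"
    using assms by (intro sum.mono_neutral_right) auto
  moreover have "(\<Sum>j<fst G. adj G i j * x i * x j) = (\<Sum>j\<in>T. adj G i j * x i * x j)" for i
    using assms by (intro sum.mono_neutral_right) auto
  moreover have "(\<Sum>i<fst G. \<Sum>j\<in>T. adj G i j * x i * x j) = (\<Sum>i\<in>T. \<Sum>j\<in>T. adj G i j * x i * x j)"
    using assms by (intro sum.mono_neutral_right) auto
  ultimately show ?thesis unfolding Q_form_def by simp
qed

text \<open>At an isolated vertex the unit vector violates the bound. At a vertex \<open>i\<close>
  with single neighbour \<open>j\<close>, take a large value at \<open>i\<close> and -1 at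
  \<open>j\<close>: the square of the large value cancels on both sides, and the negative cross term
  decides.\<close>

lemma degree_ge_2_if_form_ge_norm:
  assumes G: "simple_graph G" and form: "\<And>x. (\<Sum>i<fst G. (x i)\<^sup>2) \<le> Q_form G x" and i: "i < fst G"
  shows "degree_of G i \<ge> 2"
proof (rule ccontr)
  assume "\<not> degree_of G i \<ge> 2"
  have "(\<Sum>k<fst G. (if k = i then 1 else 0)\<^sup>2) = (1::real)"
    using i by (simp add: if_distrib[of "\<lambda>z. z\<^sup>2"] cong: if_cong)
  moreover have "Q_form G (\<lambda>k. if k = i then 1 else 0) = real (degree_of G i)"
    using i adj_simple(2)[OF G] by (subst Q_form_support[of "{i}"]) auto
  ultimately have "degree_of G i \<ge> 1" using form[of "\<lambda>k. if k = i then 1 else 0"] by simp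
  hence di: "degree_of G i = 1" using \<open>\<not> degree_of G i \<ge> 2\<close> by simp
  have "{k. k < fst G \<and> snd G i k} \<noteq> {}" using di unfolding degree_of_def by (metis card.empty zero_neq_one)
  then obtain j where j: "j < fst G" "snd G i j" by auto
  hence ij: "i \<noteq> j" "adj G i j = 1" "adj G j i = 1" using G by (auto simp: simple_graph_def adj_def)
  \<comment> \<open>With this value the cross term \<open>- 2 * e\<close> outweighs the degree of
    \<open>j\<close>, however large that is.\<close>
  define e where "e = real (degree_of G j) + 1"
  have "e > 0" unfolding e_def by simp
  define x where "x k = (if k = i then e else if k = j then -1 else 0)" for k
  have "(\<Sum>k<fst G. (x k)\<^sup>2) = (\<Sum>k\<in>{i, j}. (x k)\<^sup>2)"
    using i j by (intro sum.mono_neutral_right) (auto simp: x_def)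
  also have "\<dots> = e\<^sup>2 + 1" using ij by (simp add: x_def)
  finally have 1: "(\<Sum>k<fst G. (x k)\<^sup>2) = e\<^sup>2 + 1" .
  have "Q_form G x = e\<^sup>2 + real (degree_of G j) - 2 * e"
    using i j ij adj_simple(2)[OF G] di by (subst Q_form_support[of "{i, j}"]) (auto simp: x_def)
  thus False using form[of x] 1 \<open>e > 0\<close> unfolding e_def by simp
qed

text \<open>The plane spanned by the unit vector at a vertex of large degree and the vector with value 4 at
  w and 1 at four of its neighbours meets every hyperplane, and on it the form exceeds 5 times
  the squared norm as soon as w has degree at least 5.\<close>

lemma degree_le_4_if_form_le_five:
  assumes G: "simple_graph G"
    and form: "\<And>x. (\<Sum>i<fst G. p i * x i) = 0 \<Longrightarrow> Q_form G x \<le> 5 * (\<Sum>i<fst G. (x i)\<^sup>2)"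
    and deg2: "\<And>i. i < fst G \<Longrightarrow> degree_of G i \<ge> 2"
    and v: "v < fst G" "degree_of G v \<ge> 26" and w: "w < fst G" "w \<noteq> v"
  shows "degree_of G w \<le> 4"
proof (rule ccontr)
  assume "\<not> degree_of G w \<le> 4"
  hence w5: "degree_of G w \<ge> 5" by simp
  let ?d = "\<lambda>i. real (degree_of G i)" and ?a = "adj G"
  have "card ({k. k < fst G \<and> snd G w k} - {v}) \<ge> 4"
    using w5 diff_card_le_card_Diff[of "{v}" "{k. k < fst G \<and> snd G w k}"] unfolding degree_of_def by simp
  from obtain_subset_with_card_n[OF this]
  obtain L where L: "L \<subseteq> {k. k < fst G \<and> snd G w k} - {v}" "card L = 4" "finite L" by blast
  have Lw: "w \<notin> L" "v \<notin> L" using L G by (auto simp: simple_graph_def)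
  have aL: "?a w l = 1" "?a l w = 1" "l < fst G" if "l \<in> L" for l
    using L that G by (auto simp: adj_def simple_graph_def)
  have aww: "?a w w = 0" "?a v v = 0" using adj_simple(2)[OF G] by auto
  \<comment> \<open>Half the cross term between the unit vector at \<open>v\<close> and the star
    vector at \<open>w\<close>; it is at most 4 + 4 = 8.\<close>
  define c where "c = 4 * ?a v w + (\<Sum>l\<in>L. ?a v l)"
  have a1: "0 \<le> ?a i j" "?a i j \<le> 1" for i j by (auto simp: adj_def)
  have "(\<Sum>l\<in>L. ?a v l) \<le> (\<Sum>l\<in>L. 1)" by (intro sum_mono a1)
  hence c: "0 \<le> c" "c \<le> 8" unfolding c_def using L a1 by (auto intro!: add_nonneg_nonneg sum_nonneg add_mono[of _ 4 _ 4, simplified])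
  define s where "s = 4 * p w + (\<Sum>l\<in>L. p l)"
  \<comment> \<open>Coefficients of a nonzero vector of the plane that lies in the given
    hyperplane.\<close>
  obtain \<alpha> \<beta> :: real where ab: "\<alpha> \<noteq> 0 \<or> \<beta> \<noteq> 0" "\<alpha> * p v + \<beta> * s = 0"
  proof (cases "p v = 0")
    case True thus ?thesis using that[of 1 0] by simp
  next
    case False thus ?thesis using that[of "- s" "p v"] by simp
  qed
  define x where "x k = (if k = v then \<alpha> else if k = w then 4 * \<beta> else if k \<in> L then \<beta> else 0)" for k
  define T where "T = insert v (insert w L)"
  have T: "T \<subseteq> {..<fst G}" "\<And>i. i \<notin> T \<Longrightarrow> x i = 0"
    using v w aL by (auto simp: T_def x_def)
  have xL: "l \<in> L \<Longrightarrow> x l = \<beta>" for l using Lw by (auto simp: x_def)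
  have xvw: "x v = \<alpha>" "x w = 4 * \<beta>" using w by (auto simp: x_def)
  have sumT: "(\<Sum>i\<in>T. f i) = f v + (f w + (\<Sum>l\<in>L. f l))" for f :: "nat \<Rightarrow> real"
    unfolding T_def using Lw w L by simp
  have sumT': "(\<Sum>i<fst G. f i * x i) = (\<Sum>i\<in>T. f i * x i)" for f
    using T by (intro sum.mono_neutral_right) auto
  have "(\<Sum>i<fst G. p i * x i) = 0"
    unfolding sumT' sumT xvw s_def using ab(2) unfolding s_def
    by (simp add: xL sum_distrib_left algebra_simps)
  from form[OF this] have F: "Q_form G x \<le> 5 * (\<Sum>i<fst G. (x i)\<^sup>2)" .
  have "(\<Sum>i<fst G. (x i)\<^sup>2) = (\<Sum>i<fst G. x i * x i)" by (simp add: power2_eq_square)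
  also have "\<dots> = \<alpha>\<^sup>2 + 20 * \<beta>\<^sup>2"
    unfolding sumT' sumT xvw using L by (simp add: xL power2_eq_square)
  finally have norm: "(\<Sum>i<fst G. (x i)\<^sup>2) = \<alpha>\<^sup>2 + 20 * \<beta>\<^sup>2" .
  have q1: "(\<Sum>i\<in>T. ?d i * (x i)\<^sup>2) \<ge> 26 * \<alpha>\<^sup>2 + 88 * \<beta>\<^sup>2"
  proof -
    have "(\<Sum>l\<in>L. ?d l * (x l)\<^sup>2) \<ge> (\<Sum>l\<in>L. 2 * \<beta>\<^sup>2)"
      using deg2 aL by (intro sum_mono) (auto simp: xL intro!: mult_right_mono)
    hence "(\<Sum>l\<in>L. ?d l * (x l)\<^sup>2) \<ge> 8 * \<beta>\<^sup>2" using L by simp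
    moreover have "?d v * \<alpha>\<^sup>2 \<ge> 26 * \<alpha>\<^sup>2" using v by (intro mult_right_mono) auto
    moreover have "?d w * (4 * \<beta>)\<^sup>2 \<ge> 5 * (4 * \<beta>)\<^sup>2" using w5 by (intro mult_right_mono) auto
    moreover have "5 * (4 * \<beta>)\<^sup>2 = 80 * \<beta>\<^sup>2" by (simp add: power2_eq_square)
    ultimately show ?thesis unfolding sumT xvw by linarith
  qed
  have q2: "(\<Sum>i\<in>T. \<Sum>j\<in>T. ?a i j * x i * x j) \<ge> 2 * \<alpha> * \<beta> * c + 32 * \<beta>\<^sup>2"
  proof -
    have r1: "(\<Sum>j\<in>T. ?a v j * x v * x j) = \<alpha> * \<beta> * c"
      unfolding sumT xvw c_def using aww by (simp add: xL sum_distrib_left algebra_simps)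
    have r2: "(\<Sum>j\<in>T. ?a w j * x w * x j) = ?a v w * 4 * \<alpha> * \<beta> + 16 * \<beta>\<^sup>2"
      unfolding sumT xvw using aww aL L adj_simple(1)[OF G, of w v] by (simp add: xL power2_eq_square)
    have "(\<Sum>l\<in>L. \<Sum>j\<in>T. ?a l j * x l * x j) \<ge> (\<Sum>l\<in>L. ?a v l * \<alpha> * \<beta> + 4 * \<beta>\<^sup>2)"
    proof (rule sum_mono)
      fix l assume l: "l \<in> L"
      have "(\<Sum>j\<in>L. ?a l j * x l * x j) = (\<Sum>j\<in>L. ?a l j * \<beta>\<^sup>2)"
        using l by (intro sum.cong) (auto simp: xL power2_eq_square)
      also have "\<dots> \<ge> 0" using a1 by (intro sum_nonneg) auto
      finally show "?a v l * \<alpha> * \<beta> + 4 * \<beta>\<^sup>2 \<le> (\<Sum>j\<in>T. ?a l j * x l * x j)"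
        unfolding sumT xvw using l aL adj_simple(1)[OF G, of l v] by (simp add: xL power2_eq_square)
    qed
    moreover have "(\<Sum>l\<in>L. ?a v l * \<alpha> * \<beta> + 4 * \<beta>\<^sup>2) = \<alpha> * \<beta> * (\<Sum>l\<in>L. ?a v l) + 16 * \<beta>\<^sup>2"
      using L by (simp add: sum.distrib sum_distrib_left algebra_simps)
    ultimately have "(\<Sum>i\<in>T. \<Sum>j\<in>T. ?a i j * x i * x j) \<ge>
      \<alpha> * \<beta> * c + (?a v w * 4 * \<alpha> * \<beta> + 16 * \<beta>\<^sup>2) + (\<alpha> * \<beta> * (\<Sum>l\<in>L. ?a v l) + 16 * \<beta>\<^sup>2)"
      unfolding sumT[of "\<lambda>i. \<Sum>j\<in>T. ?a i j * x i * x j"] r1 r2 by simp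
    also have "\<alpha> * \<beta> * c + (?a v w * 4 * \<alpha> * \<beta> + 16 * \<beta>\<^sup>2) + (\<alpha> * \<beta> * (\<Sum>l\<in>L. ?a v l) + 16 * \<beta>\<^sup>2) =
      2 * \<alpha> * \<beta> * c + 32 * \<beta>\<^sup>2"
      unfolding c_def by (simp add: algebra_simps)
    finally show ?thesis .
  qed
  \<comment> \<open>The star vector has squared norm 20 and form at least 80 + 8 + 32 = 120, which
    beats 5 * 20 by 20; the unit vector at \<open>v\<close> beats 5 by 21. The cross term takes away
    at most 8 from each.\<close>
  have "26 * \<alpha>\<^sup>2 + 88 * \<beta>\<^sup>2 + (2 * \<alpha> * \<beta> * c + 32 * \<beta>\<^sup>2) \<le> 5 * (\<alpha>\<^sup>2 + 20 * \<beta>\<^sup>2)"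
  proof -
    have "Q_form G x = (\<Sum>i\<in>T. ?d i * (x i)\<^sup>2) + (\<Sum>i\<in>T. \<Sum>j\<in>T. ?a i j * x i * x j)"
      by (rule Q_form_support) (use T in auto)
    thus ?thesis using F q1 q2 unfolding norm by linarith
  qed
  hence "21 * \<alpha>\<^sup>2 + 20 * \<beta>\<^sup>2 + 2 * \<alpha> * \<beta> * c \<le> 0" by simp
  moreover have "- (2 * \<alpha> * \<beta> * c) \<le> 8 * \<alpha>\<^sup>2 + 8 * \<beta>\<^sup>2"
  proof -
    have "- (2 * \<alpha> * \<beta>) \<le> \<alpha>\<^sup>2 + \<beta>\<^sup>2"
      using zero_le_power2[of "\<alpha> + \<beta>"] by (simp add: power2_sum)
    hence "- (2 * \<alpha> * \<beta>) * c \<le> (\<alpha>\<^sup>2 + \<beta>\<^sup>2) * c" using c by (intro mult_right_mono) auto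
    also have "\<dots> \<le> (\<alpha>\<^sup>2 + \<beta>\<^sup>2) * 8" using c by (intro mult_left_mono) auto
    finally show ?thesis by simp
  qed
  ultimately have "13 * \<alpha>\<^sup>2 + 12 * \<beta>\<^sup>2 \<le> 0" by simp
  moreover have "\<alpha>\<^sup>2 > 0 \<or> \<beta>\<^sup>2 > 0" using ab(1) by auto
  ultimately show False using zero_le_power2[of \<alpha>] zero_le_power2[of \<beta>] by linarith
qed

lemma degree_of_le: "simple_graph G \<Longrightarrow> i < fst G \<Longrightarrow> degree_of G i \<le> fst G - 1"
proof -
  assume G: "simple_graph G" "i < fst G"
  have "{k. k < fst G \<and> snd G i k} \<subseteq> {..<fst G} - {i}" using G by (auto simp: simple_graph_def)
  from card_mono[OF _ this] show ?thesis using G by (simp add: degree_of_def)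
qed

lemma hub_if_degree_max:
  assumes G: "simple_graph G" and u: "u < fst G" "degree_of G u = fst G - 1" and i: "i < fst G" "i \<noteq> u"
  shows "snd G u i"
proof -
  have sub: "{k. k < fst G \<and> snd G u k} \<subseteq> {..<fst G} - {u}" using G by (auto simp: simple_graph_def)
  have "card {k. k < fst G \<and> snd G u k} = card ({..<fst G} - {u})" using u by (simp add: degree_of_def)
  hence "{k. k < fst G \<and> snd G u k} = {..<fst G} - {u}" by (intro card_subset_eq[OF _ sub]) auto
  thus ?thesis using i by blast
qed

context hub_graph
begin

lemma sum_degrees: "(\<Sum>i<n. d i) = real n - 1 + 3 * real num_deg3 + 2 * real num_deg2"
  and sum_squared_degrees: "(\<Sum>i<n. (d i)\<^sup>2) = (real n - 1)\<^sup>2 + 9 * real num_deg3 + 4 * real num_deg2"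
  unfolding sum_split deg_hub using sum_deg_N[of real] sum_deg_N[of "\<lambda>k. (real k)\<^sup>2"] by auto

text \<open>Two test polynomials in the degree e do the work. On {2, 3, 4} the product (e - 2)(e -
  4) is nonpositive, which forces \<open>v\<close> to be adjacent to all other vertices. Then (e -
  2)(e - 3), which is nonnegative there, sums to 0 and excludes degree 4.\<close>

lemma hub_graph_if_degree_sums_eq:
  assumes H: "simple_graph H" and nH: "fst H = n"
    and s1: "(\<Sum>i<n. real (degree_of H i)) = (\<Sum>i<n. d i)"
    and s2: "(\<Sum>i<n. (real (degree_of H i))\<^sup>2) = (\<Sum>i<n. (d i)\<^sup>2)"
    and v: "v < n" "degree_of H v \<ge> 7"
    and range: "\<And>i. i < n \<Longrightarrow> i \<noteq> v \<Longrightarrow> degree_of H i \<in> {2..4}"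
  shows "hub_graph H v" "hub_graph.num_deg3 H v = num_deg3"
proof -
  define M where "M = {..<n} - {v}"
  define e where "e i = real (degree_of H i)" for i
  have split: "(\<Sum>i<n. f i) = f v + (\<Sum>i\<in>M. f i)" for f :: "nat \<Rightarrow> real"
    unfolding M_def using v by (simp add: sum.remove)
  have cM: "real (card M) = real n - 1" using v by (simp add: M_def)
  have SP: "real num_deg2 = real n - 1 - real num_deg3" using num_deg_sum by linarith
  have r: "e i = 2 \<or> e i = 3 \<or> e i = 4" if "i \<in> M" for i
  proof -
    have "degree_of H i = 2 \<or> degree_of H i = 3 \<or> degree_of H i = 4"
      using range[of i] that by (auto simp: M_def)
    thus ?thesis by (auto simp: e_def)
  qed
  have S1: "(\<Sum>i\<in>M. e i) = 3 * (real n - 1) + real num_deg3 - e v"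
    using s1 unfolding sum_degrees SP unfolding split e_def[symmetric] by (simp add: algebra_simps)
  have S2: "(\<Sum>i\<in>M. (e i)\<^sup>2) = (real n - 1)\<^sup>2 + 5 * real num_deg3 + 4 * (real n - 1) - (e v)\<^sup>2"
    using s2 unfolding sum_squared_degrees SP unfolding split e_def[symmetric] by (simp add: algebra_simps)
  have "(\<Sum>i\<in>M. (e i)\<^sup>2 - 6 * e i + 8) \<le> 0"
    by (rule sum_nonpos) (use r in force)
  hence "(\<Sum>i\<in>M. (e i)\<^sup>2) - 6 * (\<Sum>i\<in>M. e i) + 8 * (real n - 1) \<le> 0"
    using cM by (simp add: sum.distrib sum_subtractf sum_distrib_left)
  hence "(real n - 1)\<^sup>2 - (e v)\<^sup>2 - 6 * (real n - 1 - e v) \<le> real num_deg3"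
    unfolding S1 S2 by (simp add: algebra_simps)
  hence ineq: "(real n - 1 - e v) * (real n + e v - 7) \<le> real num_deg3"
    by (simp add: power2_eq_square algebra_simps)
  \<comment> \<open>Otherwise the first factor in \<open>ineq\<close> is at least 1, so that n + e v
    - 7 \<le> n - 1, against \<open>e v \<ge> 7\<close>.\<close>
  have "degree_of H v = n - 1"
  proof (rule ccontr)
    assume "degree_of H v \<noteq> n - 1"
    hence "degree_of H v + 2 \<le> n" using degree_of_le[OF H, of v] v nH by simp
    hence le: "1 * (real n + e v - 7) \<le> (real n - 1 - e v) * (real n + e v - 7)"
      using v unfolding e_def by (intro mult_right_mono) auto
    have "real num_deg3 \<le> real n - 1" using num_deg_sum by linarith
    moreover have "e v \<ge> 7" using v by (simp add: e_def)
    ultimately show False using order_trans[OF le ineq] by simp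
  qed
  hence ev: "e v = real n - 1" unfolding e_def using v by simp
  have "(\<Sum>i\<in>M. (e i)\<^sup>2 - 5 * e i + 6) = (\<Sum>i\<in>M. (e i)\<^sup>2) - 5 * (\<Sum>i\<in>M. e i) + 6 * (real n - 1)"
    using cM by (simp add: sum.distrib sum_subtractf sum_distrib_left)
  also have "\<dots> = 0" unfolding S1 S2 ev by (simp add: power2_eq_square algebra_simps)
  finally have z: "(\<Sum>i\<in>M. (e i)\<^sup>2 - 5 * e i + 6) = 0" .
  have fM: "finite M" by (simp add: M_def)
  have pz: "(e i)\<^sup>2 - 5 * e i + 6 = 0" if "i \<in> M" for i
  proof (rule sum_nonneg_0[OF fM _ z that])
    fix i assume "i \<in> M"
    thus "0 \<le> (e i)\<^sup>2 - 5 * e i + 6" using r[of i] by auto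
  qed
  have deg': "degree_of H i = 2 \<or> degree_of H i = 3" if "i < n" "i \<noteq> v" for i
    using r[of i] pz[of i] that by (auto simp: M_def e_def)
  show hub: "hub_graph H v"
    using H v nH deg' hub_if_degree_max[OF H _ _ , of v] \<open>degree_of H v = n - 1\<close>
    by unfold_locales auto
  interpret H: hub_graph H v by (rule hub)
  have "real H.num_deg3 = (\<Sum>i\<in>M. e i - 2)"
    using H.sum_deg_N[of "\<lambda>k. real k - 2"] unfolding H.N_def M_def e_def nH by simp
  also have "\<dots> = real num_deg3" using cM S1 ev by (simp add: sum_subtractf)
  finally show "H.num_deg3 = num_deg3" by simp
qed

text \<open>Comparing the eigenvector of the cone with the one of an arbitrary hub graph gives
  the vanishing of the sum of a i j * (y i - y j) * (z i - z j), all of whose terms are nonnegative.\<close>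

lemma cone_graph_if_large_eigenvalue:
  assumes ev: "eigenvalue (signless_laplacian G) l"
    and l: "l > 5" "l = real n - 1 + (\<Sum>i\<in>N. weight l i)"
  shows "cone_graph G u"
proof -
  obtain y0 where y0: "\<exists>i<n. y0 i \<noteq> 0"
    "\<And>i. i < n \<Longrightarrow> l * y0 i = d i * y0 i + (\<Sum>j<n. a i j * y0 j)"
    using eigenvalue_signless_laplacianE[OF ev] by blast
  have iN: "i < n" "i \<noteq> u" if "i \<in> N" for i using that by (auto simp: N_def)
  have Nne: "N \<noteq> {}"
  proof
    assume "N = {}"
    thus False using l real_card_N by simp
  qed
  have row0: "(l - d i) * y0 i = y0 u + (\<Sum>j\<in>N. a i j * y0 j)" if "i \<in> N" for i
    using y0(2)[OF iN(1)[OF that]] a_hub(2)[OF that] unfolding sum_split by (simp add: algebra_simps)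
  \<comment> \<open>On the base the matrix has row sums \<open>2 * d i - 1\<close>, at most 5, so an
    eigenvector for \<open>l > 5\<close> cannot vanish at the hub.\<close>
  have "y0 u \<noteq> 0"
  proof
    assume 0: "y0 u = 0"
    define m where "m = Max ((\<lambda>i. \<bar>y0 i\<bar>) ` N)"
    have "m \<in> (\<lambda>i. \<bar>y0 i\<bar>) ` N" unfolding m_def using Nne by (intro Max_in) auto
    then obtain i where i: "i \<in> N" "m = \<bar>y0 i\<bar>" by auto
    have le: "\<bar>y0 j\<bar> \<le> m" if "j \<in> N" for j unfolding m_def using that by (intro Max_ge) auto
    have "(l - d i) * m \<le> \<bar>(l - d i) * y0 i\<bar>" by (simp add: i abs_mult mult_right_mono)
    also have "\<dots> \<le> (\<Sum>j\<in>N. \<bar>a i j * y0 j\<bar>)" unfolding row0[OF i(1)] 0 using sum_abs by simp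
    also have "\<dots> \<le> (\<Sum>j\<in>N. a i j * m)" using le by (intro sum_mono) (auto simp: adj_def)
    also have "\<dots> = (d i - 1) * m" using sum_adj_N[OF i(1)] by (simp add: sum_distrib_right[symmetric])
    finally have "(l + 1 - 2 * d i) * m \<le> 0" by (simp add: algebra_simps)
    moreover have "l + 1 - 2 * d i > 0" using deg_N[OF i(1)] l(1) by auto
    ultimately have "m \<le> 0" by (simp add: mult_le_0_iff)
    hence "y0 j = 0" if "j < n" for j using le[of j] 0 that by (cases "j = u") (auto simp: N_def)
    thus False using y0(1) by blast
  qed
  define y where "y i = y0 i / y0 u" for i
  have row: "(l - d i) * y i = 1 + (\<Sum>j\<in>N. a i j * y j)" if "i \<in> N" for i
  proof -
    have "(l - d i) * y i = ((l - d i) * y0 i) / y0 u" by (simp add: y_def)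
    thus ?thesis unfolding row0[OF that] using \<open>y0 u \<noteq> 0\<close>
      by (simp add: y_def add_divide_distrib sum_divide_distrib)
  qed
  have "l * y0 u = (real n - 1) * y0 u + (\<Sum>j\<in>N. y0 j)"
    using y0(2)[OF u] irr[of u] unfolding sum_split deg_hub by (simp add: a_hub)
  hence rowu: "l = real n - 1 + (\<Sum>j\<in>N. y j)"
    using \<open>y0 u \<noteq> 0\<close> by (simp add: y_def sum_divide_distrib[symmetric] field_simps)
  \<comment> \<open>The row at the minimum \<open>m\<close> of \<open>y\<close> gives 1 \<le> (l + 1
    - 2 d) m with a positive coefficient.\<close>
  have pos: "y i > 0" if "i \<in> N" for i
  proof -
    define m where "m = Min (y ` N)"
    have "m \<in> y ` N" unfolding m_def using Nne by (intro Min_in) auto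
    then obtain k where k: "k \<in> N" "m = y k" by auto
    have le: "m \<le> y j" if "j \<in> N" for j unfolding m_def using that by (intro Min_le) auto
    have "1 + (d k - 1) * m = 1 + (\<Sum>j\<in>N. a k j * m)"
      using sum_adj_N[OF k(1)] by (simp add: sum_distrib_right[symmetric])
    also have "\<dots> \<le> 1 + (\<Sum>j\<in>N. a k j * y j)"
      using le by (intro add_left_mono sum_mono) (auto simp: adj_def)
    also have "\<dots> = (l - d k) * m" using row[OF k(1)] k by simp
    finally have "1 \<le> (l + 1 - 2 * d k) * m" by (simp add: algebra_simps)
    moreover have "l + 1 - 2 * d k > 0" using deg_N[OF k(1)] l(1) by auto
    ultimately have "m > 0" using zero_less_mult_pos[of "l + 1 - 2 * d k" m] by linarith
    thus ?thesis using le[OF that] by simp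
  qed
  let ?z = "weight l"
  have wz: "(l + 1 - 2 * d i) * ?z i = 1" if "i \<in> N" for i
    using deg_N[OF that] l(1) iN[OF that] by (auto simp: weight_def)
  have sw: "(\<Sum>i\<in>N. \<Sum>j\<in>N. a i j * (f j * g i)) = (\<Sum>i\<in>N. \<Sum>j\<in>N. a i j * (f i * g j))" for f g :: "nat \<Rightarrow> real"
    by (subst sum.swap) (simp add: sym)
  have dg: "(\<Sum>i\<in>N. \<Sum>j\<in>N. a i j * (f i * g i)) = (\<Sum>i\<in>N. (d i - 1) * (f i * g i))" for f g :: "nat \<Rightarrow> real"
    by (simp add: sum_distrib_right[symmetric] sum_adj_N)
  \<comment> \<open>After expansion, the rows for \<open>y\<close> and the equation
    \<open>wz\<close> of the weights turn the double sum into twice the sum of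
    \<open>?z i - y i\<close>. Both vectors sum to l - (n - 1), the hub row, so the result is
    0.\<close>
  have "(\<Sum>i\<in>N. \<Sum>j\<in>N. a i j * ((y i - y j) * (?z i - ?z j))) =
    (\<Sum>i\<in>N. \<Sum>j\<in>N. a i j * (y i * ?z i) + a i j * (y j * ?z j) - a i j * (y j * ?z i) - a i j * (y i * ?z j))"
    by (intro sum.cong refl) (simp add: algebra_simps)
  also have "\<dots> = (\<Sum>i\<in>N. \<Sum>j\<in>N. a i j * (y i * ?z i)) + (\<Sum>i\<in>N. \<Sum>j\<in>N. a i j * (y j * ?z j))
    - (\<Sum>i\<in>N. \<Sum>j\<in>N. a i j * (y j * ?z i)) - (\<Sum>i\<in>N. \<Sum>j\<in>N. a i j * (y i * ?z j))"
    by (simp only: sum.distrib sum_subtractf)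
  also have "(\<Sum>i\<in>N. \<Sum>j\<in>N. a i j * (y j * ?z j)) = (\<Sum>i\<in>N. \<Sum>j\<in>N. a i j * (y i * ?z i))"
    by (subst sum.swap) (simp add: sym)
  also have "(\<Sum>i\<in>N. \<Sum>j\<in>N. a i j * (y i * ?z j)) = (\<Sum>i\<in>N. \<Sum>j\<in>N. a i j * (y j * ?z i))"
    by (rule sw[symmetric])
  also have "(\<Sum>i\<in>N. \<Sum>j\<in>N. a i j * (y j * ?z i)) = (\<Sum>i\<in>N. ?z i * (\<Sum>j\<in>N. a i j * y j))"
    by (simp add: sum_distrib_left mult_ac)
  also have "\<dots> = (\<Sum>i\<in>N. ?z i * ((l - d i) * y i - 1))"
    by (intro sum.cong refl) (simp add: row)
  finally have "(\<Sum>i\<in>N. \<Sum>j\<in>N. a i j * ((y i - y j) * (?z i - ?z j))) =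
    2 * ((\<Sum>i\<in>N. (d i - 1) * (y i * ?z i)) - (\<Sum>i\<in>N. ?z i * ((l - d i) * y i - 1)))" unfolding dg by simp
  also have "(\<Sum>i\<in>N. (d i - 1) * (y i * ?z i)) - (\<Sum>i\<in>N. ?z i * ((l - d i) * y i - 1)) =
    (\<Sum>i\<in>N. ?z i - ((l + 1 - 2 * d i) * ?z i) * y i)"
    unfolding sum_subtractf[symmetric] by (intro sum.cong refl) (simp add: algebra_simps)
  also have "\<dots> = (\<Sum>i\<in>N. ?z i - y i)" by (intro sum.cong refl) (simp add: wz)
  also have "\<dots> = 0" unfolding sum_subtractf using l(2) rowu by linarith
  finally have zero: "(\<Sum>i\<in>N. \<Sum>j\<in>N. a i j * ((y i - y j) * (?z i - ?z j))) = 0" by simp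
  \<comment> \<open>In the base, \<open>i\<close> is the only neighbour of \<open>j\<close>, so (l -
    2) y_j = 1 + y_i, while (l - 3) y_i exceeds 1 because \<open>y\<close> is positive. Hence
    \<open>y\<close> and the weights are ordered alike across an edge with unequal degrees.\<close>
  have gt: "y i > y j \<and> ?z i > ?z j"
    if ij: "i \<in> N" "j \<in> N" "snd G i j" "d i = 3" "d j = 2" for i j
  proof
    have aij: "a i j = 1" "a j i = 1" using ij sym[of i j] by (auto simp: adj_def)
    have "(\<Sum>k\<in>N. a j k) = a j i + (\<Sum>k\<in>N - {i}. a j k)" using ij by (simp add: sum.remove)
    hence "(\<Sum>k\<in>N - {i}. a j k) = 0" using sum_adj_N[OF ij(2)] ij(5) aij by simp
    hence "a j k = 0" if "k \<in> N - {i}" for k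
      using that adj_simple(3)[OF simple] by (subst (asm) sum_nonneg_eq_0_iff) auto
    hence "(\<Sum>k\<in>N. a j k * y k) = y i" using ij aij by (subst sum.remove[of _ i]) auto
    hence 1: "(l - 2) * y j = 1 + y i" using row[OF ij(2)] ij(5) by simp
    have "a i j * y j \<le> (\<Sum>k\<in>N. a i k * y k)"
      by (intro member_le_sum mult_nonneg_nonneg less_imp_le[OF pos] adj_simple(3)[OF simple]) (use ij in auto)
    hence 2: "(l - 3) * y i > 1" using row[OF ij(1)] ij(4) aij pos[OF ij(2)] by simp
    have "(l - 2) * (y i - y j) = ((l - 3) * y i - 1) + (1 + y i - (l - 2) * y j)" by (simp add: algebra_simps)
    hence "(l - 2) * (y i - y j) > 0" using 1 2 by simp
    thus "y i > y j" using l(1) by (simp add: zero_less_mult_iff)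
    show "?z i > ?z j" using ij l(1) iN[OF ij(1)] iN[OF ij(2)] by (simp add: weight_def frac_less2)
  qed
  have prod_pos: "(y i - y j) * (?z i - ?z j) > 0"
    if "i \<in> N" "j \<in> N" "snd G i j" "degree_of G i \<noteq> degree_of G j" for i j
  proof -
    have ji: "snd G j i" using simple that by (auto simp: simple_graph_def)
    have "(d i = 3 \<and> d j = 2) \<or> (d i = 2 \<and> d j = 3)" using deg_N[OF that(1)] deg_N[OF that(2)] that(4) by auto
    thus ?thesis using gt[OF that(1,2,3)] gt[OF that(2,1) ji] by (auto intro: mult_pos_pos mult_neg_neg)
  qed
  have eq0: "(y i - y j) * (?z i - ?z j) = 0" if "i \<in> N" "j \<in> N" "degree_of G i = degree_of G j" for i j
    using that by (simp add: weight_def N_def)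
  have nonneg: "a i j * ((y i - y j) * (?z i - ?z j)) \<ge> 0" if "i \<in> N" "j \<in> N" for i j
    using prod_pos[OF that] eq0[OF that] by (cases "degree_of G i = degree_of G j") (auto simp: adj_def)
  have term0: "a i j * ((y i - y j) * (?z i - ?z j)) = 0" if ij: "i \<in> N" "j \<in> N" for i j
  proof -
    have "(\<Sum>j\<in>N. a i j * ((y i - y j) * (?z i - ?z j))) = 0"
      by (rule sum_nonneg_0[OF finite_N _ zero ij(1)]) (auto intro: sum_nonneg nonneg)
    thus ?thesis by (rule sum_nonneg_0[OF finite_N _ _ ij(2), rotated]) (use nonneg ij in auto)
  qed
  show ?thesis
  proof unfold_locales
    fix i j assume ij: "i \<noteq> u" "j \<noteq> u" "snd G i j"
    hence "i \<in> N" "j \<in> N" using simple by (auto simp: N_def simple_graph_def)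
    thus "degree_of G i = degree_of G j"
      using prod_pos[of i j] term0[of i j] ij
      by (cases "degree_of G i = degree_of G j") (auto simp: adj_def)
  qed
qed

end

theorem (in cone_graph) cospectral_mate_is_cone:
  assumes H: "simple_graph H" and nH: "fst H = n" and n: "n \<ge> 52"
    and cp: "char_poly (signless_laplacian H) = char_poly (signless_laplacian G)"
  obtains v where "cone_graph H v" "hub_graph.num_deg3 H v = num_deg3"
proof -
  obtain w where w: "\<And>x. Q_form H x = Q_form G (\<lambda>i. \<Sum>j<n. w i j * x j)"
    "\<And>x. (\<Sum>i<n. (\<Sum>j<n. w i j * x j)\<^sup>2) = (\<Sum>i<n. (x i)\<^sup>2)"
    using cospectral_Q_form[OF simple H nH cp] by blast
  obtain l where l: "l > real n" "l = real n - 1 + (\<Sum>i\<in>N. weight l i)"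
    using exists_large_root n by auto
  hence l5: "l > 5" using n by simp
  have ev: "eigenvalue (signless_laplacian H) l"
    using weight_eigenvector[OF l5 l(2)] cp signless_laplacian_carrier eigenvalue_root_char_poly by metis
  obtain v where v: "v < n" "l \<le> 2 * real (degree_of H v)"
    using eigenvalue_le_twice_degree[OF H ev] nH by auto
  \<comment> \<open>The bound 52 is twice the degree 26 required by
    \<open>degree_le_4_if_form_le_five\<close>.\<close>
  have dv: "degree_of H v \<ge> 26" using v(2) l(1) n by linarith
  have deg2: "degree_of H i \<ge> 2" if "i < n" for i
  proof (rule degree_ge_2_if_form_ge_norm[OF H])
    show "(\<Sum>i<fst H. (x i)\<^sup>2) \<le> Q_form H x" for x
      using Q_form_ge_norm[of "\<lambda>i. \<Sum>j<n. w i j * x j"] n unfolding w nH by simp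
  qed (use that nH in simp)
  \<comment> \<open>Row \<open>u\<close> of \<open>w\<close> is the normal vector: the hyperplane
    consists of the \<open>x\<close> whose image vanishes at the hub of \<open>G\<close>.\<close>
  have deg4: "degree_of H i \<le> 4" if "i < n" "i \<noteq> v" for i
  proof (rule degree_le_4_if_form_le_five[OF H, of "w u"])
    show "Q_form H x \<le> 5 * (\<Sum>i<fst H. (x i)\<^sup>2)" if "(\<Sum>i<fst H. w u i * x i) = 0" for x
      using Q_form_le_five[of "\<lambda>i. \<Sum>j<n. w i j * x j"] that unfolding w nH by simp
  qed (use that nH deg2 v dv in auto)
  note sums = cospectral_degree_sums[OF simple H nH cp]
  have hub: "hub_graph H v" "hub_graph.num_deg3 H v = num_deg3"
    by (rule hub_graph_if_degree_sums_eq[OF H nH sums v(1)]; use dv deg2 deg4 in auto)+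
  interpret H: hub_graph H v by (rule hub)
  \<comment> \<open>Equal counts make \<open>l\<close>, chosen for \<open>G\<close>, solve the hub
    equation of \<open>H\<close> as well.\<close>
  have "H.num_deg2 = num_deg2" using H.num_deg_sum num_deg_sum hub(2) nH by simp
  hence sw: "(\<Sum>i\<in>H.N. H.weight l i) = (\<Sum>i\<in>N. weight l i)"
    unfolding H.sum_weight sum_weight hub(2) by simp
  have "cone_graph H v"
    by (rule H.cone_graph_if_large_eigenvalue[OF ev l5]) (unfold sw nH, rule l(2))
  thus ?thesis using that hub by blast
qed

section \<open>Recovering the cycle lengths\<close>

text \<open>On a cycle with rotation s the matrix B below acts as 3 + s + s^-1, so the k-th term of the
  Chebyshev recursion acts as s^k + s^-k and its trace is twice the number of fixed points of s^k.\<close>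

fun cheb :: "real mat \<Rightarrow> nat \<Rightarrow> real mat" where
  "cheb B 0 = 2 \<cdot>\<^sub>m 1\<^sub>m (dim_row B)"
| "cheb B (Suc 0) = B - 3 \<cdot>\<^sub>m 1\<^sub>m (dim_row B)"
| "cheb B (Suc (Suc k)) = (B - 3 \<cdot>\<^sub>m 1\<^sub>m (dim_row B)) * cheb B (Suc k) - cheb B k"

lemma cheb_carrier: "B \<in> carrier_mat n n \<Longrightarrow> cheb B k \<in> carrier_mat n n"
proof (induction B k rule: cheb.induct)
  case (3 B k)
  thus ?case by auto
qed auto

text \<open>Conjugation respects sums, products and scalar matrices, so it passes through the
  recursion; this carries the Chebyshev traces over to a similar matrix.\<close>

lemma cheb_similar:
  assumes W: "W \<in> carrier_mat n n" "V \<in> carrier_mat n n" "V * W = 1\<^sub>m n" "W * V = 1\<^sub>m n"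
    and B: "B \<in> carrier_mat n n"
  shows "cheb (W * B * V) k = W * cheb B k * V"
proof -
  note assoc = assoc_mult_mat[of _ n n _ n _ n]
  have smult: "W * (c \<cdot>\<^sub>m 1\<^sub>m n) * V = c \<cdot>\<^sub>m 1\<^sub>m n" for c
    using W by (simp add: mult_smult_distrib[of _ n n _ n] mult_smult_assoc_mat[of _ n n _ n])
  have minus: "W * (X - Y) * V = W * X * V - W * Y * V" if "X \<in> carrier_mat n n" "Y \<in> carrier_mat n n" for X Y
    using W that by (simp add: mult_minus_distrib_mat[of _ n n _ n] minus_mult_distrib_mat[of _ n n _ _ n])
  have mult: "W * (X * Y) * V = (W * X * V) * (W * Y * V)" if X: "X \<in> carrier_mat n n" and Y: "Y \<in> carrier_mat n n" for X Y
  proof -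
    have "(W * X * V) * (W * Y * V) = W * (X * ((V * W) * (Y * V)))"
      using W(1,2) X Y by (simp add: assoc)
    thus ?thesis unfolding W(3) using W(1,2) X Y by (simp add: assoc)
  qed
  have dim: "dim_row (W * B * V) = n" "dim_row B = n" using W B by auto
  have one: "(3::real) \<cdot>\<^sub>m 1\<^sub>m n \<in> carrier_mat n n" by auto
  show ?thesis
    using B dim
  proof (induction B k rule: cheb.induct)
    case (1 B)
    thus ?case by (simp only: cheb.simps smult)
  next
    case (2 B)
    show ?case unfolding cheb.simps 2(2) 2(3) minus[OF 2(1) one] smult ..
  next
    case (3 B k)
    note c = cheb_carrier[OF 3(3)]
    have "B - 3 \<cdot>\<^sub>m 1\<^sub>m n \<in> carrier_mat n n" using 3(3) by auto
    thus ?case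
      unfolding cheb.simps 3(4) 3(5) 3(1)[OF 3(3,4,5)] 3(2)[OF 3(3,4,5)]
      using c 3(3) one by (simp only: minus mult smult mult_carrier_mat)
  qed
qed

text \<open>The coefficients of the identity and of the swap in the Chebyshev sequence of the
  two-vertex block.\<close>

fun edge_coeff :: "nat \<Rightarrow> real \<times> real" where
  "edge_coeff 0 = (2, 0)"
| "edge_coeff (Suc 0) = (- 1, 1)"
| "edge_coeff (Suc (Suc k)) =
    (snd (edge_coeff (Suc k)) - fst (edge_coeff (Suc k)) - fst (edge_coeff k),
     fst (edge_coeff (Suc k)) - snd (edge_coeff (Suc k)) - snd (edge_coeff k))"

context hub_graph
begin

text \<open>The value 5 on the diagonal makes the hub behave like a fixed point of the orientation.\<close>

definition core_mat :: "real mat" where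
  "core_mat = mat n n (\<lambda>(i, j). if i = u \<or> j = u then (if i = j then 5 else 0)
     else a i j + (if i = j then d i else 0))"

lemma core_mat_carrier: "core_mat \<in> carrier_mat n n" by (simp add: core_mat_def)

lemma core_mat_symmetric: "transpose_mat core_mat = core_mat"
  by (rule eq_matI) (auto simp: core_mat_def sym)

end

section \<open>Splitting off the apex by a determinant identity\<close>

lemma det_column_single:
  fixes A :: "'a :: comm_ring_1 mat"
  assumes A: "A \<in> carrier_mat n n" and j: "j < n" and z: "\<And>i. i < n \<Longrightarrow> i \<noteq> j \<Longrightarrow> A $$ (i, j) = 0"
  shows "det A = A $$ (j, j) * det (mat_delete A j j)"
proof -
  have "det A = (\<Sum>i<n. A $$ (i, j) * cofactor A i j)" by (rule laplace_expansion_column[OF A j])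
  also have "\<dots> = (\<Sum>i\<in>{j}. A $$ (i, j) * cofactor A i j)"
    using z j by (intro sum.mono_neutral_right) auto
  finally show ?thesis by (simp add: cofactor_def)
qed

text \<open>A column operation on x - Q, written as the matrix \<open>E\<close> of determinant 1:
  adding the base columns with factors \<open>weight x\<close> to the hub column clears it except at
  the hub, because the weights solve the base system with right-hand side 1. The entry left at the
  hub is \<open>g\<close>. The excluded points are the poles of the weights, and
  \<open>x - 5\<close> comes from the hub entry of \<open>core_mat\<close>.\<close>

lemma (in cone_graph) char_poly_core_mat:
  assumes x: "x \<noteq> 3" "x \<noteq> 5"
  shows "(x - 5) * poly (char_poly (signless_laplacian G)) x =
    (x - (real n - 1) - (\<Sum>i\<in>N. weight x i)) * poly (char_poly core_mat) x"
proof -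
  define g where "g = x - (real n - 1) - (\<Sum>i\<in>N. weight x i)"
  define A where "A = mat n n (\<lambda>(i, j). (if i = j then x - d i else 0) - a i j)"
  define B where "B = - char_matrix core_mat x"
  have A: "A \<in> carrier_mat n n" and B: "B \<in> carrier_mat n n"
    using core_mat_carrier by (auto simp: A_def B_def)
  have Aeq: "- char_matrix (signless_laplacian G) x = A"
    by (rule eq_matI) (auto simp: A_def char_matrix_def signless_laplacian_def adj_def)
  have Bij: "B $$ (i, j) = (if i = j then x else 0) - core_mat $$ (i, j)" if "i < n" "j < n" for i j
    using that core_mat_carrier by (auto simp: B_def char_matrix_def)
  define E where "E = mat n n (\<lambda>(i, j). if j = u then weight x i else if i = j then 1 else 0)"
  have E: "E \<in> carrier_mat n n" by (simp add: E_def)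
  have detE: "det E = 1"
  proof -
    have "det (transpose_mat E) = transpose_mat E $$ (u, u) * det (mat_delete (transpose_mat E) u u)"
      by (rule det_column_single[of _ n]) (use u E in \<open>auto simp: E_def\<close>)
    moreover have "mat_delete (transpose_mat E) u u = 1\<^sub>m (n - 1)"
      by (rule eq_matI) (use u in \<open>auto simp: mat_delete_def E_def\<close>)
    moreover have "E $$ (u, u) = 1" using u by (simp add: E_def weight_def)
    ultimately show ?thesis using u E det_transpose[OF E] by simp
  qed
  have AE: "(A * E) $$ (i, j) = (if j = u then (if i = u then g else 0) else A $$ (i, j))"
    if i: "i < n" and j: "j < n" for i j
  proof -
    have "(A * E) $$ (i, j) = (\<Sum>k<n. A $$ (i, k) * E $$ (k, j))"
      using i j A E by (auto simp: scalar_prod_def lessThan_atLeast0)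
    also have "\<dots> = (if j = u then (if i = u then g else 0) else A $$ (i, j))"
    proof (cases "j = u")
      case False
      have "(\<Sum>k<n. A $$ (i, k) * E $$ (k, j)) = (\<Sum>k<n. if k = j then A $$ (i, k) else 0)"
        using j False by (intro sum.cong) (auto simp: E_def)
      thus ?thesis using False j by simp
    next
      case True
      have "(\<Sum>k<n. A $$ (i, k) * E $$ (k, j)) =
        (\<Sum>k<n. (if i = k then (x - d i) * weight x k else 0) - a i k * weight x k)"
        using i u True by (intro sum.cong) (auto simp: E_def A_def left_diff_distrib)
      also have "\<dots> = (x - d i) * weight x i - (\<Sum>k<n. a i k * weight x k)"
        using i by (simp add: sum_subtractf)
      also have "\<dots> = (if i = u then g else 0)"
      proof (cases "i = u")
        case True
        have "weight x u = 1" by (simp add: weight_def)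
        thus ?thesis using True irr[of u] unfolding sum_split g_def by (simp add: a_hub deg_hub)
      next
        case False
        hence iN: "i \<in> N" using i by (simp add: N_def)
        have "(x - d i) * weight x i - (\<Sum>k<n. a i k * weight x k) = (x + 1 - 2 * d i) * weight x i - 1"
          unfolding sum_split sum_adj_weight[OF iN] using iN by (simp add: a_hub weight_def[of x u] algebra_simps)
        moreover have "(x + 1 - 2 * d i) * weight x i = 1"
          using deg_N[OF iN] x False by (auto simp: weight_def)
        ultimately show ?thesis using False by simp
      qed
      finally show ?thesis using True by simp
    qed
    finally show ?thesis .
  qed
  have AEc: "A * E \<in> carrier_mat n n" using A E by auto
  have "poly (char_poly (signless_laplacian G)) x = det (A * E)"
    unfolding char_poly_matrix[OF signless_laplacian_carrier] Aeq det_mult[OF A E] detE by simp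
  also have "\<dots> = g * det (mat_delete (A * E) u u)"
    using det_column_single[OF AEc u] u by (simp add: AE del: index_mult_mat)
  also have "mat_delete (A * E) u u = mat_delete B u u"
  proof (rule eq_matI)
    fix i j assume "i < dim_row (mat_delete B u u)" "j < dim_col (mat_delete B u u)"
    hence ij: "i < n - 1" "j < n - 1" using B by auto
    let ?i = "if i < u then i else Suc i" and ?j = "if j < u then j else Suc j"
    have b: "?i < n" "?j < n" "?i \<noteq> u" "?j \<noteq> u" using ij by auto
    have del: "mat_delete M u u $$ (i, j) = M $$ (?i, ?j)" if "M \<in> carrier_mat n n" for M :: "real mat"
      unfolding mat_delete_def using ij that by simp
    have "mat_delete (A * E) u u $$ (i, j) = (A * E) $$ (?i, ?j)" by (rule del[OF AEc])
    also have "\<dots> = A $$ (?i, ?j)" unfolding AE[OF b(1,2)] using b(4) by metis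
    also have "\<dots> = B $$ (?i, ?j)"
      unfolding Bij[OF b(1,2)] core_mat_def A_def using b by auto
    also have "\<dots> = mat_delete B u u $$ (i, j)" by (rule del[OF B, symmetric])
    finally show "mat_delete (A * E) u u $$ (i, j) = mat_delete B u u $$ (i, j)" .
  qed (use AEc B in auto)
  finally have 1: "poly (char_poly (signless_laplacian G)) x = g * det (mat_delete B u u)" .
  have "poly (char_poly core_mat) x = det B"
    unfolding B_def by (rule char_poly_matrix[OF core_mat_carrier])
  also have "\<dots> = (x - 5) * det (mat_delete B u u)"
    using det_column_single[OF B u] u by (simp add: Bij core_mat_def)
  finally show ?thesis unfolding 1 g_def by simp
qed

lemma poly_eq_if_eventually_eq:
  fixes p q :: "real poly"
  assumes "\<And>x. x > c \<Longrightarrow> poly p x = poly q x"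
  shows "p = q"
proof (rule ccontr)
  assume "p \<noteq> q"
  hence "finite {x. poly (p - q) x = 0}" by (intro poly_roots_finite) simp
  moreover have "{c<..} \<subseteq> {x. poly (p - q) x = 0}" using assms by auto
  ultimately show False using infinite_Ioi[of c] finite_subset by blast
qed

text \<open>The factor in front of the core polynomial depends only on the order and the degree
  counts, hence is common to both graphs. It can be cancelled for all large \<open>x\<close>, which
  is enough to identify polynomials.\<close>

lemma cone_graph_char_poly_core_mat_eq:
  assumes G: "cone_graph G u" and H: "cone_graph H v" and nH: "fst H = fst G"
    and num_deg3: "hub_graph.num_deg3 H v = hub_graph.num_deg3 G u"
    and cp: "char_poly (signless_laplacian H) = char_poly (signless_laplacian G)"
  shows "char_poly (hub_graph.core_mat H v) = char_poly (hub_graph.core_mat G u)"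
proof -
  interpret G: cone_graph G u by (rule G)
  interpret H: cone_graph H v by (rule H)
  have num_deg2: "H.num_deg2 = G.num_deg2" using H.num_deg_sum G.num_deg_sum num_deg3 nH by simp
  show ?thesis
  proof (rule poly_eq_if_eventually_eq)
    \<comment> \<open>Beyond this bound every denominator is at least 1, so the weights sum to at
      most n - 1 and \<open>g\<close> is at least x - 2 (n - 1) > 0.\<close>
    fix x assume x: "x > 2 * real G.n + 6"
    define g where "g = x - (real G.n - 1) - (\<Sum>i\<in>G.N. G.weight x i)"
    have sw: "(\<Sum>i\<in>G.N. G.weight x i) = (\<Sum>i\<in>H.N. H.weight x i)"
      unfolding G.sum_weight H.sum_weight num_deg3 num_deg2 ..
    have "(x - 5) * poly (char_poly (signless_laplacian G)) x = g * poly (char_poly G.core_mat) x"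
      unfolding g_def by (rule G.char_poly_core_mat) (use x in auto)
    moreover have "(x - 5) * poly (char_poly (signless_laplacian G)) x = g * poly (char_poly H.core_mat) x"
      unfolding g_def sw nH[symmetric] cp[symmetric] by (rule H.char_poly_core_mat) (use x in auto)
    ultimately have "g * poly (char_poly H.core_mat) x = g * poly (char_poly G.core_mat) x" by metis
    moreover have "g > 0"
    proof -
      have "(\<Sum>i\<in>G.N. G.weight x i) \<le> (\<Sum>i\<in>G.N. 1)"
      proof (rule sum_mono)
        fix i assume i: "i \<in> G.N"
        have "x + 1 - 2 * G.d i \<ge> 1" using G.deg_N[OF i] x by auto
        thus "G.weight x i \<le> 1" by (simp add: G.weight_def)
      qed
      thus ?thesis unfolding g_def using x G.real_card_N by simp
    qed
    ultimately show "poly (char_poly H.core_mat) x = poly (char_poly G.core_mat) x" by simp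
  qed
qed

section \<open>Traces of the core matrix of an oriented cone\<close>

text \<open>The orientation of the base is extended to all vertices by fixing the hub; a two-vertex
  component is a 2-cycle of \<open>s\<close>.\<close>

locale oriented_cone = cone_graph +
  fixes s :: "nat \<Rightarrow> nat"
  assumes s_bij: "bij_betw s {..<n} {..<n}" and s_u: "s u = u"
    and nbr: "\<And>i j. i \<in> N \<Longrightarrow> j \<in> N \<Longrightarrow> snd G i j \<longleftrightarrow> j = s i \<or> i = s j"

lemma (in cone_graph) card_nbrs_N:
  assumes "i \<in> N"
  shows "card {j \<in> N. snd G i j} = degree_of G i - 1"
proof -
  have "snd G i u" using a_hub(2)[OF assms] by (auto simp: adj_def split: if_splits)
  hence "{k. k < n \<and> snd G i k} = insert u {j \<in> N. snd G i j}" using u by (auto simp: N_def)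
  moreover have "u \<notin> {j \<in> N. snd G i j}" by (simp add: N_def)
  ultimately show ?thesis unfolding degree_of_def by simp
qed

lemma (in cone_graph) oriented_cone_exists:
  obtains s where "oriented_cone G u s"
proof -
  have "\<exists>s. bij_betw s N N \<and> (\<forall>x\<in>N. \<forall>y\<in>N. snd G x y \<longleftrightarrow> y = s x \<or> x = s y)"
  proof (rule orientation_exists[of N "snd G"])
    show "finite N" by simp
    show "snd G x y \<Longrightarrow> snd G y x" "\<not> snd G x x" for x y
      using simple by (auto simp: simple_graph_def)
    show "card {y \<in> N. snd G x y} = 1 \<or> card {y \<in> N. snd G x y} = 2" if "x \<in> N" for x
      using card_nbrs_N[OF that] deg_N[OF that] by auto
    show "card {z \<in> N. snd G x z} = card {z \<in> N. snd G y z}" if "x \<in> N" "y \<in> N" "snd G x y" for x y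
      using card_nbrs_N[OF that(1)] card_nbrs_N[OF that(2)] hom[of x y] that by (auto simp: N_def)
  qed blast
  then obtain t where t: "bij_betw t N N" "\<And>x y. x \<in> N \<Longrightarrow> y \<in> N \<Longrightarrow> snd G x y \<longleftrightarrow> y = t x \<or> x = t y"
    by blast
  let ?s = "\<lambda>x. if x = u then u else t x"
  have "bij_betw ?s N N" using t(1) by (subst bij_betw_cong[of _ _ t]) (auto simp: N_def)
  moreover have "bij_betw ?s {u} {u}" by simp
  ultimately have "bij_betw ?s (N \<union> {u}) (N \<union> {u})"
    by (rule bij_betw_combine) (auto simp: N_def)
  moreover have "N \<union> {u} = {..<n}" using u by (auto simp: N_def)
  ultimately have "oriented_cone G u ?s"
    using t(2) by unfold_locales (auto simp: N_def)
  thus ?thesis using that by blast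
qed

context oriented_cone
begin

definition "p = inv_into {..<n} s"

lemma s_lt: "i < n \<Longrightarrow> s i < n" using s_bij by (auto simp: bij_betw_def)
lemma p_lt: "i < n \<Longrightarrow> p i < n" unfolding p_def using s_bij by (metis bij_betw_def inv_into_into lessThan_iff)
lemma s_p: "i < n \<Longrightarrow> s (p i) = i" unfolding p_def using bij_betw_inv_into_right[OF s_bij] by simp
lemma p_s: "i < n \<Longrightarrow> p (s i) = i" unfolding p_def using bij_betw_inv_into_left[OF s_bij] by simp

lemma p_u: "p u = u" using p_s[OF u] s_u by simp

lemma s_N: "i \<in> N \<Longrightarrow> s i \<in> N"
  using s_lt[of i] p_s[of i] p_u by (auto simp: N_def)

lemma p_N: "i \<in> N \<Longrightarrow> p i \<in> N"
  using p_lt[of i] s_p[of i] s_u by (auto simp: N_def)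

lemma nbr': "i \<in> N \<Longrightarrow> j \<in> N \<Longrightarrow> snd G i j \<longleftrightarrow> j = s i \<or> j = p i"
  using nbr[of i j] p_s[of j] s_p[of i] by (auto simp: N_def)

lemma nbrs_eq: "i \<in> N \<Longrightarrow> {j \<in> N. snd G i j} = {s i, p i}"
  using nbr'[of i] s_N[of i] p_N[of i] by auto

lemma s_p_eq_iff: "i \<in> N \<Longrightarrow> s i = p i \<longleftrightarrow> degree_of G i = 2"
proof -
  assume i: "i \<in> N"
  have "card {s i, p i} = degree_of G i - 1" using card_nbrs_N[OF i] nbrs_eq[OF i] by simp
  thus ?thesis using deg_N[OF i] by (cases "s i = p i") auto
qed

lemma s_ne: "i \<in> N \<Longrightarrow> s i \<noteq> i" "i \<in> N \<Longrightarrow> p i \<noteq> i"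
  using nbr'[of i i] simple by (auto simp: simple_graph_def)

lemma deg_s: "i \<in> N \<Longrightarrow> degree_of G (s i) = degree_of G i" "i \<in> N \<Longrightarrow> degree_of G (p i) = degree_of G i"
  using nbr'[of i "s i"] nbr'[of i "p i"] hom[of i "s i"] hom[of i "p i"] s_N[of i] p_N[of i]
  by (auto simp: N_def)

text \<open>The vertices on which \<open>core_mat\<close> minus 3 is the sum of \<open>s\<close> and
  its inverse; the other vertices form the two-vertex components.\<close>

definition "C = {i. i < n \<and> (i = u \<or> degree_of G i = 3)}"

lemma C_s: "j \<in> C \<Longrightarrow> s j \<in> C" "j \<in> C \<Longrightarrow> p j \<in> C"
  using deg_s[of j] s_lt[of j] p_lt[of j] s_u p_u by (cases "j = u"; auto simp: C_def N_def)+

lemma C_pow: "j \<in> C \<Longrightarrow> (s ^^ k) j \<in> C" "j \<in> C \<Longrightarrow> (p ^^ k) j \<in> C"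
  by (induction k) (auto simp: C_s)

lemma not_C: "j < n \<Longrightarrow> j \<notin> C \<Longrightarrow> j \<in> N \<and> degree_of G j = 2"
  using deg[of j] by (auto simp: C_def N_def)

lemma core_C:
  assumes i: "i < n" and j: "j \<in> C"
  shows "(core_mat - 3 \<cdot>\<^sub>m 1\<^sub>m n) $$ (i, j) = of_bool (i = s j) + of_bool (i = p j)"
proof -
  have jn: "j < n" using j by (simp add: C_def)
  have e: "(core_mat - 3 \<cdot>\<^sub>m 1\<^sub>m n) $$ (i, j) = core_mat $$ (i, j) - (if i = j then 3 else 0)"
    using i jn core_mat_carrier by simp
  show ?thesis
  proof (cases "j = u")
    case True
    thus ?thesis unfolding e using i jn s_u p_u by (auto simp: core_mat_def)
  next
    case False
    hence jN: "j \<in> N" and d3: "degree_of G j = 3" using j by (auto simp: C_def N_def)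
    show ?thesis
    proof (cases "i = u")
      case True
      thus ?thesis unfolding e using False jn i s_N[OF jN] p_N[OF jN] by (auto simp: core_mat_def N_def)
    next
      case iu: False
      hence iN: "i \<in> N" using i by (simp add: N_def)
      have ne: "s j \<noteq> p j" using s_p_eq_iff[OF jN] d3 by simp
      show ?thesis
        unfolding e using False iu i jn d3 irr ne s_ne[OF jN] nbr'[OF jN iN] sym[of i j]
        by (auto simp: core_mat_def adj_def)
    qed
  qed
qed

text \<open>Here the diagonal entry is 2, one less than on a cycle, and successor and predecessor
  are the same vertex, counted once: the block is the swap minus the identity.\<close>

lemma core_not_C:
  assumes i: "i < n" and j: "j < n" "j \<notin> C"
  shows "(core_mat - 3 \<cdot>\<^sub>m 1\<^sub>m n) $$ (i, j) = of_bool (i = s j) - of_bool (i = j)"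
proof -
  have e: "(core_mat - 3 \<cdot>\<^sub>m 1\<^sub>m n) $$ (i, j) = core_mat $$ (i, j) - (if i = j then 3 else 0)"
    using i j core_mat_carrier by simp
  have jN: "j \<in> N" and d2: "degree_of G j = 2" using not_C[OF j] by auto
  hence ju: "j \<noteq> u" by (simp add: N_def)
  show ?thesis
  proof (cases "i = u")
    case True
    thus ?thesis unfolding e using ju j i s_N[OF jN] by (auto simp: core_mat_def N_def)
  next
    case iu: False
    hence iN: "i \<in> N" using i by (simp add: N_def)
    have "s j = p j" using s_p_eq_iff[OF jN] d2 by simp
    thus ?thesis
      unfolding e using ju iu i j d2 irr s_ne[OF jN] nbr'[OF jN iN] sym[of i j]
      by (auto simp: core_mat_def adj_def)
  qed
qed

lemma s_s_not_C: "j < n \<Longrightarrow> j \<notin> C \<Longrightarrow> s (s j) = j"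
  using not_C[of j] s_p_eq_iff[of j] s_p[of j] by auto

lemma s_not_C: "j < n \<Longrightarrow> j \<notin> C \<Longrightarrow> s j \<notin> C"
  using C_s(1)[of "s j"] s_s_not_C[of j] by auto

text \<open>On \<open>C\<close>, multiplying s^(k+1) + s^-(k+1) by s + s^-1 yields the next term
  plus s^k + s^-k, which the recursion subtracts. Off \<open>C\<close>, the span of identity and
  swap is closed under the recursion, with coefficients \<open>edge_coeff\<close>.\<close>

lemma cheb_core:
  assumes "i < n" "j < n"
  shows "cheb core_mat k $$ (i, j) =
    (if j \<in> C then of_bool (i = (s ^^ k) j) + of_bool (i = (p ^^ k) j)
     else fst (edge_coeff k) * of_bool (i = j) + snd (edge_coeff k) * of_bool (i = s j))"
  using assms
proof (induction k arbitrary: i j rule: induct_nat_012)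
  case 0
  thus ?case using core_mat_carrier by simp
next
  case 1
  thus ?case using core_C[of i j] core_not_C[of i j] core_mat_carrier by simp
next
  case (ge2 k)
  let ?B = "core_mat - 3 \<cdot>\<^sub>m 1\<^sub>m n"
  have B: "?B \<in> carrier_mat n n" using core_mat_carrier by auto
  \<comment> \<open>A column of the previous term is a combination of two unit vectors, so
    multiplying by \<open>?B\<close> just combines two columns of \<open>?B\<close>.\<close>
  have pick: "(\<Sum>l<n. ?B $$ (i, l) * (\<alpha> * of_bool (l = x) + \<beta> * of_bool (l = y))) = \<alpha> * ?B $$ (i, x) + \<beta> * ?B $$ (i, y)"
    if "x < n" "y < n" for x y \<alpha> \<beta>
  proof -
    have "(\<Sum>l<n. ?B $$ (i, l) * (\<alpha> * of_bool (l = x) + \<beta> * of_bool (l = y))) =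
      (\<Sum>l<n. (if l = x then \<alpha> * ?B $$ (i, x) else 0) + (if l = y then \<beta> * ?B $$ (i, y) else 0))"
      by (rule sum.cong) (auto simp: algebra_simps)
    thus ?thesis using that by (simp add: sum.distrib)
  qed
  have "cheb core_mat (Suc (Suc k)) $$ (i, j) =
    (\<Sum>l<n. ?B $$ (i, l) * cheb core_mat (Suc k) $$ (l, j)) - cheb core_mat k $$ (i, j)"
    using ge2.prems B core_mat_carrier cheb_carrier[OF core_mat_carrier, of k] cheb_carrier[OF core_mat_carrier, of "Suc k"]
    by (simp add: scalar_prod_def lessThan_atLeast0 del: cheb.simps(2,3) index_minus_mat index_smult_mat)
       (simp add: scalar_prod_def lessThan_atLeast0)
  also have "\<dots> = (if j \<in> C then of_bool (i = (s ^^ Suc (Suc k)) j) + of_bool (i = (p ^^ Suc (Suc k)) j)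
     else fst (edge_coeff (Suc (Suc k))) * of_bool (i = j) + snd (edge_coeff (Suc (Suc k))) * of_bool (i = s j))"
  proof (cases "j \<in> C")
    case True
    let ?x = "(s ^^ Suc k) j" and ?y = "(p ^^ Suc k) j"
    have xy: "?x \<in> C" "?y \<in> C" using C_pow[OF True] by blast+
    hence lt: "?x < n" "?y < n" by (auto simp: C_def)
    have k: "(s ^^ k) j < n" "(p ^^ k) j < n" using C_pow[OF True, of k] by (auto simp: C_def)
    have "(\<Sum>l<n. ?B $$ (i, l) * cheb core_mat (Suc k) $$ (l, j)) =
      (\<Sum>l<n. ?B $$ (i, l) * (1 * of_bool (l = ?x) + 1 * of_bool (l = ?y)))"
      using ge2.IH(2) ge2.prems True by (intro sum.cong) auto
    also have "\<dots> = ?B $$ (i, ?x) + ?B $$ (i, ?y)" unfolding pick[OF lt] by simp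
    also have "\<dots> = of_bool (i = s ?x) + of_bool (i = p ?x) + (of_bool (i = s ?y) + of_bool (i = p ?y))"
      unfolding core_C[OF ge2.prems(1) xy(1)] core_C[OF ge2.prems(1) xy(2)] ..
    also have "p ?x = (s ^^ k) j" using p_s[OF k(1)] by simp
    also have "s ?y = (p ^^ k) j" using s_p[OF k(2)] by simp
    finally show ?thesis using ge2.IH(1)[OF ge2.prems] True by simp
  next
    case False
    have "(\<Sum>l<n. ?B $$ (i, l) * cheb core_mat (Suc k) $$ (l, j)) =
      (\<Sum>l<n. ?B $$ (i, l) * (fst (edge_coeff (Suc k)) * of_bool (l = j) + snd (edge_coeff (Suc k)) * of_bool (l = s j)))"
      using ge2.IH(2) ge2.prems False by (intro sum.cong) auto
    also have "\<dots> = fst (edge_coeff (Suc k)) * ?B $$ (i, j) + snd (edge_coeff (Suc k)) * ?B $$ (i, s j)"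
      using pick[OF ge2.prems(2) s_lt[OF ge2.prems(2)]] by blast
    also have "?B $$ (i, j) = of_bool (i = s j) - of_bool (i = j)"
      by (rule core_not_C[OF ge2.prems False])
    also have "?B $$ (i, s j) = of_bool (i = j) - of_bool (i = s j)"
      using core_not_C[OF ge2.prems(1) s_lt[OF ge2.prems(2)] s_not_C[OF ge2.prems(2) False]]
        s_s_not_C[OF ge2.prems(2) False] by simp
    finally show ?thesis using ge2.IH(1)[OF ge2.prems] False by (simp add: algebra_simps)
  qed
  finally show ?case .
qed

lemma s_pow_lt: "i < n \<Longrightarrow> (s ^^ k) i < n" by (induction k) (auto simp: s_lt)

lemma p_pow_lt: "i < n \<Longrightarrow> (p ^^ k) i < n" by (induction k) (auto simp: p_lt)

lemma s_p_pow: "i < n \<Longrightarrow> (s ^^ k) ((p ^^ k) i) = i" "i < n \<Longrightarrow> (p ^^ k) ((s ^^ k) i) = i"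
proof (induction k)
  case (Suc k)
  have "(s ^^ Suc k) ((p ^^ Suc k) i) = (s ^^ k) (s (p ((p ^^ k) i)))"
    "(p ^^ Suc k) ((s ^^ Suc k) i) = (p ^^ k) (p (s ((s ^^ k) i)))" if "i < n"
    by (simp_all add: funpow_swap1)
  thus "i < n \<Longrightarrow> (s ^^ Suc k) ((p ^^ Suc k) i) = i" "i < n \<Longrightarrow> (p ^^ Suc k) ((s ^^ Suc k) i) = i"
    using Suc s_p[OF p_pow_lt[of i k]] p_s[OF s_pow_lt[of i k]] by simp_all
qed simp_all

lemma card_not_C: "card ({..<n} - C) = num_deg2"
proof -
  have "{..<n} - C = {i \<in> N. degree_of G i = 2}" using not_C by (auto simp: C_def N_def)
  thus ?thesis by (simp add: num_deg2_def)
qed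

text \<open>The factor 2 arises because \<open>s ^^ k\<close> and its inverse fix the same points.
  The swap has no diagonal entries, so each vertex off \<open>C\<close> contributes a constant that
  depends on \<open>k\<close> only.\<close>

lemma mat_trace_cheb_core:
  "mat_trace (cheb core_mat k) = 2 * real (card {i \<in> C. (s ^^ k) i = i}) + fst (edge_coeff k) * real num_deg2"
proof -
  have fin: "finite C" and sub: "C \<subseteq> {..<n}" by (auto simp: C_def)
  have "mat_trace (cheb core_mat k) = (\<Sum>i<n. cheb core_mat k $$ (i, i))"
    using cheb_carrier[OF core_mat_carrier, of k] by (simp add: mat_trace_def)
  also have "\<dots> = (\<Sum>i<n. if i \<in> C then 2 * of_bool ((s ^^ k) i = i) else fst (edge_coeff k))"
  proof (rule sum.cong[OF refl])
    fix i assume "i \<in> {..<n}"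
    hence i: "i < n" by simp
    have "i = (p ^^ k) i \<longleftrightarrow> (s ^^ k) i = i" using s_p_pow[OF i, of k] by metis
    moreover have "i \<noteq> s i" if "i \<notin> C" using not_C[OF i that] s_ne(1)[of i] by auto
    ultimately show "cheb core_mat k $$ (i, i) = (if i \<in> C then 2 * of_bool ((s ^^ k) i = i) else fst (edge_coeff k))"
      unfolding cheb_core[OF i i] by auto
  qed
  also have "\<dots> = (\<Sum>i\<in>C. 2 * of_bool ((s ^^ k) i = i)) + (\<Sum>i\<in>{..<n} - C. fst (edge_coeff k))"
  proof -
    have "{..<n} \<inter> {i. i \<in> C} = C" "{..<n} \<inter> - {i. i \<in> C} = {..<n} - C" using sub by auto
    thus ?thesis by (simp add: sum.If_cases)
  qed
  also have "(\<Sum>i\<in>C. 2 * of_bool ((s ^^ k) i = i)) = 2 * real (card {i \<in> C. (s ^^ k) i = i})"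
    using fin by (simp add: sum_distrib_left[symmetric] of_bool_def sum.If_cases Collect_conj_eq Int_commute)
  finally show ?thesis using card_not_C by simp
qed

text \<open>Every power fixes the hub, which lies in \<open>C\<close> but not in \<open>N\<close>:
  hence the \<open>+ 1\<close>. The ends of two-vertex components are fixed by the even powers
  only.\<close>

lemma card_fixpoints_N:
  "card {i \<in> N. (s ^^ k) i = i} + 1 = card {i \<in> C. (s ^^ k) i = i} + (if even k then num_deg2 else 0)"
proof -
  have su: "(s ^^ k) u = u" by (induction k) (auto simp: s_u)
  have nC: "(s ^^ k) i = i \<longleftrightarrow> even k" if i: "i < n" "i \<notin> C" for i
  proof -
    have "(s ^^ k) i = (if even k then i else s i)"
      by (induction k) (auto simp: s_s_not_C[OF i])
    moreover have "s i \<noteq> i" using not_C[OF i] s_ne(1) by auto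
    ultimately show ?thesis by auto
  qed
  have u: "u \<in> C" using u by (simp add: C_def)
  have "insert u {i \<in> N. (s ^^ k) i = i} = {i \<in> C. (s ^^ k) i = i} \<union> (if even k then {..<n} - C else {})"
    using nC su u by (auto simp: N_def C_def)
  moreover have "card (insert u {i \<in> N. (s ^^ k) i = i}) = card {i \<in> N. (s ^^ k) i = i} + 1"
    by (simp add: N_def)
  moreover have "card ({i \<in> C. (s ^^ k) i = i} \<union> (if even k then {..<n} - C else {})) =
    card {i \<in> C. (s ^^ k) i = i} + (if even k then num_deg2 else 0)"
    using card_not_C by (subst card_Un_disjoint) (auto simp: C_def)
  ultimately show ?thesis by simp
qed

lemma s_bij_N: "bij_betw s N N"
proof -
  have "inj_on s N" using s_bij by (auto simp: bij_betw_def N_def intro: inj_on_subset)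
  thus ?thesis unfolding bij_betw_def using endo_inj_surj[of N s] s_N by auto
qed

end

text \<open>Adjacency in the base means being successor or predecessor, so a bijection that
  conjugates one orientation to the other is an isomorphism of the bases; it extends by matching the
  hubs.\<close>

theorem cospectral_cones_isomorphic:
  assumes G: "cone_graph G u" and H: "cone_graph H v" and nH: "fst H = fst G"
    and num_deg3: "hub_graph.num_deg3 H v = hub_graph.num_deg3 G u"
    and cp: "char_poly (signless_laplacian H) = char_poly (signless_laplacian G)"
  shows "graph_iso H G"
proof -
  obtain s where "oriented_cone G u s" using cone_graph.oriented_cone_exists[OF G] by blast
  then interpret G: oriented_cone G u s .
  obtain t where "oriented_cone H v t" using cone_graph.oriented_cone_exists[OF H] by blast
  then interpret H: oriented_cone H v t .
  have num_deg2: "H.num_deg2 = G.num_deg2" using H.num_deg_sum G.num_deg_sum num_deg3 nH by simp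
  have cH: "H.core_mat \<in> carrier_mat G.n G.n" using H.core_mat_carrier nH by simp
  obtain W where W: "W \<in> carrier_mat G.n G.n" "transpose_mat W * W = 1\<^sub>m G.n" "W * transpose_mat W = 1\<^sub>m G.n"
    "H.core_mat = W * G.core_mat * transpose_mat W"
    using cospectral_symmetric_orthogonally_similar[OF cH H.core_mat_symmetric G.core_mat_carrier
        G.core_mat_symmetric cone_graph_char_poly_core_mat_eq[OF G H nH num_deg3 cp]] by blast
  have Wt: "transpose_mat W \<in> carrier_mat G.n G.n" using W(1) by auto
  have "mat_trace (cheb H.core_mat k) = mat_trace (cheb G.core_mat k)" for k
    unfolding W(4) cheb_similar[OF W(1) Wt W(2,3) G.core_mat_carrier]
    by (rule mat_trace_similar[OF W(1) Wt cheb_carrier[OF G.core_mat_carrier] W(2)])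
  hence "card {i \<in> H.C. (t ^^ k) i = i} = card {i \<in> G.C. (s ^^ k) i = i}" for k
    unfolding H.mat_trace_cheb_core G.mat_trace_cheb_core num_deg2 by simp
  hence "card {i \<in> H.N. (t ^^ k) i = i} = card {i \<in> G.N. (s ^^ k) i = i}" for k
    using H.card_fixpoints_N[of k] G.card_fixpoints_N[of k] num_deg2 by (cases "even k") simp_all
  then obtain h where h: "bij_betw h H.N G.N" "\<And>x. x \<in> H.N \<Longrightarrow> h (t x) = s (h x)"
    using conjugate_if_card_fixpoints_eq[OF H.finite_N G.finite_N H.s_bij_N G.s_bij_N] by blast
  define f where "f x = (if x = v then u else h x)" for x
  have fN: "bij_betw f H.N G.N"
    using h(1) by (subst bij_betw_cong[of _ _ h]) (auto simp: f_def H.N_def)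
  have "bij_betw f (H.N \<union> {v}) (G.N \<union> {u})"
    using fN by (rule bij_betw_combine) (auto simp: f_def G.N_def)
  moreover have "H.N \<union> {v} = {..<fst H}" "G.N \<union> {u} = {..<fst G}"
    using H.u G.u by (auto simp: H.N_def G.N_def)
  ultimately have f: "bij_betw f {..<fst H} {..<fst G}" by simp
  have "snd H i j \<longleftrightarrow> snd G (f i) (f j)" if ij: "i < fst H" "j < fst H" for i j
  proof -
    have symG: "snd G x y \<longleftrightarrow> snd G y x" for x y using G.simple by (auto simp: simple_graph_def)
    have symH: "snd H x y \<longleftrightarrow> snd H y x" for x y using H.simple by (auto simp: simple_graph_def)
    have irr: "\<not> snd G x x" "\<not> snd H x x" for x
      using G.simple H.simple by (auto simp: simple_graph_def)
    have hubG: "snd G u (f x)" if "x \<in> H.N" for x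
      using bij_betwE[OF fN] that by (auto simp: G.N_def intro: G.hub)
    have hubH: "snd H v x" if "x \<in> H.N" for x using that by (auto simp: H.N_def intro: H.hub)
    have fv: "f v = u" by (simp add: f_def)
    consider "i = v" "j = v" | "i = v" "j \<in> H.N" | "i \<in> H.N" "j = v" | "i \<in> H.N" "j \<in> H.N"
      using ij by (auto simp: H.N_def)
    thus ?thesis
    proof cases
      case 1 thus ?thesis using irr fv by simp
    next
      case 2 thus ?thesis using hubG hubH fv by simp
    next
      case 3 thus ?thesis using hubG hubH fv symG symH by metis
    next
      case 4
      have fh: "f x = h x" if "x \<in> H.N" for x using that by (simp add: f_def H.N_def)
      have hi: "h i \<in> G.N" "h j \<in> G.N" using bij_betwE[OF h(1)] 4 by auto
      have inj: "h x = h y \<longleftrightarrow> x = y" if "x \<in> H.N" "y \<in> H.N" for x y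
        using h(1) that by (auto simp: bij_betw_def inj_on_def)
      have "snd H i j \<longleftrightarrow> j = t i \<or> i = t j" using H.nbr 4 by blast
      also have "\<dots> \<longleftrightarrow> h j = h (t i) \<or> h i = h (t j)"
        using inj[OF 4(2) H.s_N[OF 4(1)]] inj[OF 4(1) H.s_N[OF 4(2)]] by simp
      also have "\<dots> \<longleftrightarrow> h j = s (h i) \<or> h i = s (h j)" using h(2) 4 by simp
      also have "\<dots> \<longleftrightarrow> snd G (h i) (h j)" using G.nbr[OF hi] by blast
      finally show ?thesis using fh 4 by simp
    qed
  qed
  thus ?thesis unfolding graph_iso_def using f by blast
qed

section \<open>Cones over disjoint unions of cycles and edges\<close>

text \<open>A local condition instead of a list of components: it passes to disjoint unions vertex
  by vertex, and joining an apex, which raises each degree by 1, turns it into the conditions of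
  \<open>cone_graph\<close>.\<close>

definition cycles_and_edges :: "graph \<Rightarrow> bool" where
  "cycles_and_edges F \<longleftrightarrow> simple_graph F \<and>
     (\<forall>i<fst F. degree_of F i = 1 \<or> degree_of F i = 2) \<and>
     (\<forall>i j. snd F i j \<longrightarrow> degree_of F i = degree_of F j)"

lemma cycles_and_edges_empty: "cycles_and_edges empty_graph"
  by (simp add: cycles_and_edges_def empty_graph_def simple_graph_def)

lemma cycles_and_edges_K2: "cycles_and_edges K2"
proof -
  have "{k. k < fst K2 \<and> snd K2 i k} = {1 - i}" if "i < 2" for i
    using that by (auto simp: K2_def less_2_cases_iff)
  hence "degree_of K2 i = 1" if "i < 2" for i using that by (simp add: degree_of_def)
  thus ?thesis by (auto simp: cycles_and_edges_def simple_graph_def K2_def)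
qed

lemma cycles_and_edges_cycle:
  assumes "s \<ge> 3"
  shows "cycles_and_edges (cycle_graph s)"
proof -
  \<comment> \<open>The predecessor on the cycle, with wrap-around at 0; it differs from the
    successor because \<open>s \<ge> 3\<close>.\<close>
  let ?p = "\<lambda>i. if i = 0 then s - 1 else i - 1"
  have nb: "snd (cycle_graph s) i j \<longleftrightarrow> i < s \<and> j < s \<and> (j = Suc i mod s \<or> j = ?p i)" for i j
  proof -
    have "i = Suc j mod s \<longleftrightarrow> j = ?p i" if "i < s" "j < s"
      using that assms by (cases "Suc j = s") auto
    thus ?thesis by (auto simp: cycle_graph_def)
  qed
  have deg: "degree_of (cycle_graph s) i = 2" if i: "i < s" for i
  proof -
    have "Suc i mod s \<noteq> ?p i" using i assms by (cases "Suc i = s") auto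
    moreover have "{k. k < fst (cycle_graph s) \<and> snd (cycle_graph s) i k} = {Suc i mod s, ?p i}"
      unfolding nb using i assms by (auto simp: cycle_graph_def)
    ultimately show ?thesis by (simp add: degree_of_def)
  qed
  have irr: "\<not> snd (cycle_graph s) i i" for i
    using assms by (cases "Suc i = s") (auto simp: cycle_graph_def)
  show ?thesis
    unfolding cycles_and_edges_def simple_graph_def
    using deg irr by (auto simp: cycle_graph_def)
qed

lemma degree_of_gunion:
  "i < fst F \<Longrightarrow> degree_of (gunion F F') i = degree_of F i"
  "i < fst F' \<Longrightarrow> degree_of (gunion F F') (fst F + i) = degree_of F' i"
proof -
  assume "i < fst F"
  hence "{k. k < fst (gunion F F') \<and> snd (gunion F F') i k} = {k. k < fst F \<and> snd F i k}"
    by (auto simp: gunion_def)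
  thus "degree_of (gunion F F') i = degree_of F i" by (simp add: degree_of_def)
next
  assume i: "i < fst F'"
  have "{k. k < fst (gunion F F') \<and> snd (gunion F F') (fst F + i) k} = (+) (fst F) ` {k. k < fst F' \<and> snd F' i k}"
  proof (intro Set.set_eqI iffI)
    fix k assume "k \<in> {k. k < fst (gunion F F') \<and> snd (gunion F F') (fst F + i) k}"
    hence "k = fst F + (k - fst F)" "k - fst F < fst F'" "snd F' i (k - fst F)"
      by (auto simp: gunion_def)
    thus "k \<in> (+) (fst F) ` {k. k < fst F' \<and> snd F' i k}" by blast
  qed (use i in \<open>auto simp: gunion_def\<close>)
  thus "degree_of (gunion F F') (fst F + i) = degree_of F' i"
    by (simp add: degree_of_def card_image)
qed

lemma simple_graph_gunion: "simple_graph F \<Longrightarrow> simple_graph F' \<Longrightarrow> simple_graph (gunion F F')"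
  by (fastforce simp: simple_graph_def gunion_def)

lemma cycles_and_edges_gunion:
  assumes F: "cycles_and_edges F" "cycles_and_edges F'"
  shows "cycles_and_edges (gunion F F')"
  unfolding cycles_and_edges_def
proof (intro conjI allI impI)
  show "simple_graph (gunion F F')" using F simple_graph_gunion by (auto simp: cycles_and_edges_def)
next
  fix i assume "i < fst (gunion F F')"
  hence "i < fst F \<or> (fst F \<le> i \<and> i - fst F < fst F')" by (auto simp: gunion_def)
  thus "degree_of (gunion F F') i = 1 \<or> degree_of (gunion F F') i = 2"
    using F degree_of_gunion(1)[of i F F'] degree_of_gunion(2)[of "i - fst F" F' F]
    by (auto simp: cycles_and_edges_def)
next
  fix i j assume "snd (gunion F F') i j"
  then consider "i < fst F" "j < fst F" "snd F i j"
    | "fst F \<le> i" "fst F \<le> j" "i - fst F < fst F'" "j - fst F < fst F'" "snd F' (i - fst F) (j - fst F)"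
    by (auto simp: gunion_def)
  thus "degree_of (gunion F F') i = degree_of (gunion F F') j"
  proof cases
    case 1 thus ?thesis using F degree_of_gunion(1)[of i F F'] degree_of_gunion(1)[of j F F']
      by (auto simp: cycles_and_edges_def)
  next
    case 2 thus ?thesis
      using F degree_of_gunion(2)[of "i - fst F" F' F] degree_of_gunion(2)[of "j - fst F" F' F]
      by (auto simp: cycles_and_edges_def)
  qed
qed

lemma cycles_and_edges_gunion_list:
  "(\<And>F. F \<in> set Fs \<Longrightarrow> cycles_and_edges F) \<Longrightarrow> cycles_and_edges (gunion_list Fs)"
  unfolding gunion_list_def
  by (induction Fs) (auto simp: cycles_and_edges_empty cycles_and_edges_gunion)

lemma cone_graph_gjoin_K1:
  assumes F: "cycles_and_edges F"
  shows "cone_graph (gjoin K1 F) 0"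
proof -
  let ?G = "gjoin K1 F"
  have simpleF: "simple_graph F" using F by (simp add: cycles_and_edges_def)
  have n: "fst ?G = Suc (fst F)" by (simp add: gjoin_def K1_def)
  have adj0: "snd ?G 0 j \<longleftrightarrow> 0 < j \<and> j < Suc (fst F)" for j
    by (auto simp: gjoin_def gunion_def K1_def)
  have adj0': "snd ?G j 0 \<longleftrightarrow> 0 < j \<and> j < Suc (fst F)" for j
    by (auto simp: gjoin_def gunion_def K1_def)
  have adjS: "snd ?G (Suc i) (Suc j) \<longleftrightarrow> snd F i j" for i j
    using simpleF by (auto simp: gjoin_def gunion_def K1_def simple_graph_def)
  have degS: "degree_of ?G (Suc i) = Suc (degree_of F i)" if "i < fst F" for i
  proof -
    have "{k. k < fst ?G \<and> snd ?G (Suc i) k} = insert 0 (Suc ` {k. k < fst F \<and> snd F i k})"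
    proof (intro Set.set_eqI)
      fix k
      show "k \<in> {k. k < fst ?G \<and> snd ?G (Suc i) k} \<longleftrightarrow> k \<in> insert 0 (Suc ` {k. k < fst F \<and> snd F i k})"
        using adj0'[of "Suc i"] adjS[of i] n that by (cases k) auto
    qed
    thus ?thesis by (simp add: degree_of_def card_image)
  qed
  show ?thesis
  proof unfold_locales
    show "simple_graph ?G"
      unfolding simple_graph_def
    proof (intro conjI allI impI)
      fix i j assume "snd ?G i j"
      thus "i < fst ?G" "j < fst ?G" "i \<noteq> j" "snd ?G j i"
        using adj0 adj0' adjS simpleF n by (cases i; cases j; auto simp: simple_graph_def)+
    qed
    show "0 < fst ?G" using n by simp
    show "snd ?G 0 i" if "i < fst ?G" "i \<noteq> 0" for i using that adj0 n by simp
    show "degree_of ?G i = 2 \<or> degree_of ?G i = 3" if "i < fst ?G" "i \<noteq> 0" for i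
      using that degS n F by (cases i) (auto simp: cycles_and_edges_def)
    show "degree_of ?G i = degree_of ?G j" if ne: "i \<noteq> 0" "j \<noteq> 0" and e: "snd ?G i j" for i j
    proof -
      obtain i' j' where ij: "i = Suc i'" "j = Suc j'" using ne not0_implies_Suc by blast
      hence a: "snd F i' j'" using e adjS by simp
      hence "i' < fst F" "j' < fst F" using simpleF by (auto simp: simple_graph_def)
      thus ?thesis using a ij degS F by (auto simp: cycles_and_edges_def)
    qed
  qed
qed

theorem theorem1p2:
  fixes ss :: "nat list" and q :: nat
  defines "G \<equiv> gjoin K1 (gunion_list (map cycle_graph ss @ replicate q K2))"
  assumes "length ss \<ge> 2"
    and "\<forall>s \<in> set ss. s \<ge> 3"
    and "fst G \<ge> 52"
  shows "\<forall>H. simple_graph H \<and> Q_spectrum H = Q_spectrum G \<longrightarrow> graph_iso H G"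
proof (intro allI impI)
  fix H assume H: "simple_graph H \<and> Q_spectrum H = Q_spectrum G"
  have "cycles_and_edges (gunion_list (map cycle_graph ss @ replicate q K2))"
    using assms(3) by (intro cycles_and_edges_gunion_list) (auto simp: cycles_and_edges_cycle cycles_and_edges_K2)
  hence G: "cone_graph G 0" unfolding G_def by (rule cone_graph_gjoin_K1)
  interpret G: cone_graph G 0 by (rule G)
  have ord: "Polynomial.order x (char_poly (signless_laplacian H)) =
    Polynomial.order x (char_poly (signless_laplacian G))" for x
    using H unfolding Q_spectrum_def by meson
  have simpleH: "simple_graph H" using H by simp
  note cp = symmetric_char_poly_eqI[OF signless_laplacian_carrier signless_laplacian_symmetric[OF simpleH]
      signless_laplacian_carrier signless_laplacian_symmetric[OF G.simple] ord]
  obtain v where "cone_graph H v" "hub_graph.num_deg3 H v = G.num_deg3"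
    using G.cospectral_mate_is_cone[OF simpleH cp(2) assms(4) cp(1)] by blast
  thus "graph_iso H G" using cospectral_cones_isomorphic[OF G _ cp(2) _ cp(1)] by blast
qed

end
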